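(* Let $\mathbb X$ be a tangent category with negatives and let $\mathbb G=(G\rightrightarrows M)$ be a groupoid in $\mathbb X$. If $X,Y\in\mathsf{LeftInv}(G,T^sG)$ and $[X,Y]:G\to T^sG$ is the unique arrow with $[X,Y]\iota^s=[X\iota^s,Y\iota^s]$, then $[X,Y]\in\mathsf{LeftInv}(G,T^sG)$.
   Context: Composition is written in diagrammatic order: $fg$ means first $f$, then $g$. Components of natural transformations are often written without subscripts, $(f,g,\dots)$ denotes the arrow into a pullback induced by $f,g,\dots$, and $\pi_0,\pi_1$ are pullback projections. Tangent category (Cockett–Cruttwell): a category $\mathbb X$ with a functor $T:\mathbb X\to\mathbb X$ and natural transformations $p:T\Rightarrow 1$, $0:1\Rightarrow T$, $+:T_2\Rightarrow T$, $\ell:T\Rightarrow T^2$, $c:T^2\Rightarrow T^2$ such that: (i) for each $N$ the $n$-fold fibre products $T_nN$ of $p_N:TN\to N$ over $N$ exist and are preserved by all $T^m$, and $(p_N,+_N,0_N)$ is a commutative monoid in $\mathbb X/N$ (an additive bundle); (ii) $(\ell_N,0_N)$ is an additive bundle morphism from $(p_N,+_N,0_N)$ to $(T(p_N),T(+_N),T(0_N))$; (iii) $(c_N,1_{TN})$ is an additive bundle morphism from $(T(p_N),T(+_N),T(0_N))$ to $(p_{TN},+_{TN},0_{TN})$; (iv) $cc=1$, $\ell c=\ell$, $\ell\,T(\ell)=\ell\,\ell_T$, $T(c)\,c_T\,T(c)=c_T\,T(c)\,c_T$, $\ell_T\,T(c)\,c_T=c\,T(\ell)$; (v) the arrow $(\pi_0\ell,\pi_10_{TN})T(+_N):T_2N\to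 T^2N$ is the equaliser of $T(p_N)$ and $T(p_N)\,p_N\,0_N:T^2N\to TN$. It has negatives if there is a natural transformation $-:T\Rightarrow T$ making each $p_N$ an abelian group in $\mathbb X/N$. Lie bracket. A vector field on $G$ is an arrow $V:G\to TG$ with $Vp=1_G$. For vector fields $V,W$ on $G$ put $f:=V\,T(W)-W\,T(V)\,c:G\to T^2G$, the subtraction being that of the bundle $p_{TG}:T^2G\to TG$. Then $fT(p)=0_G$ and $fp_{TG}=W$, and $[V,W]=\{f\}:G\to TG$ is the unique arrow $u$ with $up=1_G$ and $f=(u\ell,\,W0_{TG})\,T(+_G)$. The groupoid $\mathbb G$ has source and target $s,t:G\to M$, identity $e:M\to G$, inverse $(-)^{-1}$ and composition $\mu:G\,{}_t\!\times_sG\to G$, with $\mu s=\pi_0s$, $\mu t=\pi_1t$. All pullbacks mentioned are assumed to exist and to be preserved by $T$; in particular $T(G\,{}_t\!\times_sG)=TG\,{}_{Tt}\!\times_{Ts}TG$. $T^sG$, with projections $\iota^s:T^sG\to TG$ and $\pi^s:T^sG\to M$, is the pullback of $Ts:TG\to TM$ along $0:M\to TM$; $p^s:=\iota^sp:T^sG\to G$. $\mu^s:G\,{}_t\!\times_{\pi^s}T^sG\to T^sG$ is the unique arrow with $\mu^s\iota^s=(\pi_00,\pi_1\iota^s)\,T\mu$ (and $\mu^s\pi^s=\pi_0s$). $\mathsf{LeftInv}(G,T^sG)$ is the set of arrows $X:G\to T^sG$ with $Xp^s=1_G$ and $(\pi_0,\pi_1X)\mu^s=\mu X$ as arrows $G\,{}_t\!\times_sG\to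 T^sG$. For $X,Y\in\mathsf{LeftInv}(G,T^sG)$ the arrow $[X\iota^s,Y\iota^s]:G\to TG$ factors (uniquely, $\iota^s$ being monic) through $\iota^s$, which defines $[X,Y]$. *)

theory Defs
  imports Main
begin

text \<open>
  Categories have carrier sets of objects and arrows; composition is written in diagrammatic
  order: \<open>f \<cdot> g\<close> is first \<open>f\<close>, then \<open>g\<close>. Values outside the carriers, and composites of
  non-composable arrows, are unspecified.
\<close>

record ('o, 'a) category =
  Ob :: "'o set"
  Ar :: "'a set"
  Dom :: "'a \<Rightarrow> 'o"
  Cod :: "'a \<Rightarrow> 'o"
  Ident :: "'o \<Rightarrow> 'a" ("\<one>\<index>")
  Comp :: "'a \<Rightarrow> 'a \<Rightarrow> 'a" (infixl "\<cdot>\<index>" 70)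

definition hom :: "('o, 'a, 'm) category_scheme \<Rightarrow> 'o \<Rightarrow> 'o \<Rightarrow> 'a set" where
  "hom C A B = {f \<in> Ar C. Dom C f = A \<and> Cod C f = B}"

locale category =
  fixes C :: "('o, 'a, 'm) category_scheme" (structure)
  assumes Dom_Ob: "f \<in> Ar C \<Longrightarrow> Dom C f \<in> Ob C"
    and Cod_Ob: "f \<in> Ar C \<Longrightarrow> Cod C f \<in> Ob C"
    and Ident_hom: "A \<in> Ob C \<Longrightarrow> \<one> A \<in> hom C A A"
    and Comp_hom: "\<lbrakk>f \<in> hom C A B; g \<in> hom C B D\<rbrakk> \<Longrightarrow> f \<cdot> g \<in> hom C A D"
    and Ident_left: "f \<in> hom C A B \<Longrightarrow> \<one> A \<cdot> f = f"
    and Ident_right: "f \<in> hom C A B \<Longrightarrow> f \<cdot> \<one> B = f"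
    and Comp_assoc: "\<lbrakk>f \<in> hom C A B; g \<in> hom C B D; h \<in> hom C D E\<rbrakk> \<Longrightarrow> (f \<cdot> g) \<cdot> h = f \<cdot> (g \<cdot> h)"

text \<open>\<open>is_pullback C f g a b\<close>: the span \<open>a, b\<close> is a pullback of the cospan \<open>f, g\<close>.\<close>

definition is_pullback ::
  "('o, 'a, 'm) category_scheme \<Rightarrow> 'a \<Rightarrow> 'a \<Rightarrow> 'a \<Rightarrow> 'a \<Rightarrow> bool" where
  "is_pullback C f g a b \<longleftrightarrow>
     f \<in> Ar C \<and> g \<in> Ar C \<and> Cod C f = Cod C g \<and>
     a \<in> hom C (Dom C a) (Dom C f) \<and> b \<in> hom C (Dom C a) (Dom C g) \<and> a \<cdot> f = b \<cdot> g \<and>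
     (\<forall>Q \<in> Ob C. \<forall>h \<in> hom C Q (Dom C f). \<forall>k \<in> hom C Q (Dom C g). h \<cdot> f = k \<cdot> g \<longrightarrow>
        (\<exists>!u. u \<in> hom C Q (Dom C a) \<and> u \<cdot> a = h \<and> u \<cdot> b = k))"
  for C (structure)

text \<open>The arrow \<open>(f, g)\<close> into a pullback with projections \<open>a, b\<close>.\<close>

definition pair :: "('o, 'a, 'm) category_scheme \<Rightarrow> 'a \<Rightarrow> 'a \<Rightarrow> 'a \<Rightarrow> 'a \<Rightarrow> 'a" where
  "pair C a b f g = (THE u. u \<in> hom C (Dom C f) (Dom C a) \<and> u \<cdot> a = f \<and> u \<cdot> b = g)"
  for C (structure)

text \<open>
  \<open>is_fibre_power C q n P \<pi>\<close>: for \<open>n \<ge> 1\<close>, the object \<open>P\<close> with projections \<open>\<pi> i\<close> (\<open>i < n\<close>) is the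
  \<open>n\<close>-fold fibre product of \<open>q\<close> over its codomain.
\<close>

definition is_fibre_power ::
  "('o, 'a, 'm) category_scheme \<Rightarrow> 'a \<Rightarrow> nat \<Rightarrow> 'o \<Rightarrow> (nat \<Rightarrow> 'a) \<Rightarrow> bool" where
  "is_fibre_power C q n P \<pi> \<longleftrightarrow>
     q \<in> Ar C \<and> P \<in> Ob C \<and> (\<forall>i<n. \<pi> i \<in> hom C P (Dom C q)) \<and>
     (\<forall>i<n. \<forall>j<n. \<pi> i \<cdot> q = \<pi> j \<cdot> q) \<and>
     (\<forall>Q \<in> Ob C. \<forall>h :: nat \<Rightarrow> 'a.
        (\<forall>i<n. h i \<in> hom C Q (Dom C q)) \<and> (\<forall>i<n. \<forall>j<n. h i \<cdot> q = h j \<cdot> q) \<longrightarrow>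
        (\<exists>!u. u \<in> hom C Q P \<and> (\<forall>i<n. u \<cdot> \<pi> i = h i)))"
  for C (structure)

definition is_equaliser :: "('o, 'a, 'm) category_scheme \<Rightarrow> 'a \<Rightarrow> 'a \<Rightarrow> 'a \<Rightarrow> bool" where
  "is_equaliser C k f g \<longleftrightarrow>
     f \<in> Ar C \<and> g \<in> hom C (Dom C f) (Cod C f) \<and>
     k \<in> hom C (Dom C k) (Dom C f) \<and> k \<cdot> f = k \<cdot> g \<and>
     (\<forall>Q \<in> Ob C. \<forall>h \<in> hom C Q (Dom C f). h \<cdot> f = h \<cdot> g \<longrightarrow>
        (\<exists>!u. u \<in> hom C Q (Dom C k) \<and> u \<cdot> k = h))"
  for C (structure)

definition nat_trans ::
  "('o, 'a, 'm) category_scheme \<Rightarrow> ('o \<Rightarrow> 'o) \<Rightarrow> ('a \<Rightarrow> 'a) \<Rightarrow> ('o \<Rightarrow> 'o) \<Rightarrow> ('a \<Rightarrow> 'a)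
    \<Rightarrow> ('o \<Rightarrow> 'a) \<Rightarrow> bool" where
  "nat_trans C FO FA GO GA \<alpha> \<longleftrightarrow>
     (\<forall>A \<in> Ob C. \<alpha> A \<in> hom C (FO A) (GO A)) \<and>
     (\<forall>f \<in> Ar C. FA f \<cdot> \<alpha> (Cod C f) = \<alpha> (Dom C f) \<cdot> GA f)"
  for C (structure)

text \<open>
  An additive bundle \<open>q : E \<rightarrow> B\<close> with chosen projections \<open>bpr 0, bpr 1\<close> of \<open>E\<^sub>2\<close>,
  addition \<open>E\<^sub>2 \<rightarrow> E\<close> and zero \<open>B \<rightarrow> E\<close>.
\<close>

record 'a bundle_data =
  bproj :: 'a
  bpr :: "nat \<Rightarrow> 'a"
  badd :: 'a
  bzero :: 'a

definition additive_bundle :: "('o, 'a, 'm) category_scheme \<Rightarrow> 'a bundle_data \<Rightarrow> bool" where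
  "additive_bundle C E \<longleftrightarrow>
     (let q = bproj E; \<pi> = bpr E; add = badd E; z = bzero E; E2 = Dom C (\<pi> 0) in
        is_fibre_power C q 2 E2 \<pi> \<and>
        add \<in> hom C E2 (Dom C q) \<and> add \<cdot> q = \<pi> 0 \<cdot> q \<and>
        z \<in> hom C (Cod C q) (Dom C q) \<and> z \<cdot> q = \<one> (Cod C q) \<and>
        (\<exists>P \<rho>. is_fibre_power C q 3 P \<rho> \<and>
           pair C (\<pi> 0) (\<pi> 1) (pair C (\<pi> 0) (\<pi> 1) (\<rho> 0) (\<rho> 1) \<cdot> add) (\<rho> 2) \<cdot> add =
           pair C (\<pi> 0) (\<pi> 1) (\<rho> 0) (pair C (\<pi> 0) (\<pi> 1) (\<rho> 1) (\<rho> 2) \<cdot> add) \<cdot> add) \<and>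
        pair C (\<pi> 0) (\<pi> 1) (\<pi> 1) (\<pi> 0) \<cdot> add = add \<and>
        pair C (\<pi> 0) (\<pi> 1) (\<one> (Dom C q)) (q \<cdot> z) \<cdot> add = \<one> (Dom C q))"
  for C (structure)

definition additive_bundle_hom ::
  "('o, 'a, 'm) category_scheme \<Rightarrow> 'a bundle_data \<Rightarrow> 'a bundle_data \<Rightarrow> 'a \<Rightarrow> 'a \<Rightarrow> bool" where
  "additive_bundle_hom C E F f g \<longleftrightarrow>
     f \<in> hom C (Dom C (bproj E)) (Dom C (bproj F)) \<and>
     g \<in> hom C (Cod C (bproj E)) (Cod C (bproj F)) \<and>
     f \<cdot> bproj F = bproj E \<cdot> g \<and>
     badd E \<cdot> f = pair C (bpr F 0) (bpr F 1) (bpr E 0 \<cdot> f) (bpr E 1 \<cdot> f) \<cdot> badd F \<and>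
     bzero E \<cdot> f = g \<cdot> bzero F"
  for C (structure)

text \<open>
  \<open>TnO X n N\<close> with \<open>Tpr X n N i\<close> (\<open>i < n\<close>) is a choice of the \<open>n\<close>-fold fibre product of \<open>p\<^sub>N\<close>.
\<close>

record ('o, 'a) tangent = "('o, 'a) category" +
  TO :: "'o \<Rightarrow> 'o"
  TA :: "'a \<Rightarrow> 'a" ("\<T>\<index>")
  tproj :: "'o \<Rightarrow> 'a" ("\<p>\<index>")
  tzero :: "'o \<Rightarrow> 'a" ("\<zero>\<index>")
  TnO :: "nat \<Rightarrow> 'o \<Rightarrow> 'o"
  Tpr :: "nat \<Rightarrow> 'o \<Rightarrow> nat \<Rightarrow> 'a"
  tadd :: "'o \<Rightarrow> 'a" ("\<oplus>\<index>")
  tlift :: "'o \<Rightarrow> 'a" ("\<l>\<index>")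
  tflip :: "'o \<Rightarrow> 'a" ("\<c>\<index>")

definition T2A :: "('o, 'a, 'm) tangent_scheme \<Rightarrow> 'a \<Rightarrow> 'a" where
  "T2A X f = pair X (Tpr X 2 (Cod X f) 0) (Tpr X 2 (Cod X f) 1)
               (Tpr X 2 (Dom X f) 0 \<cdot> \<T> f) (Tpr X 2 (Dom X f) 1 \<cdot> \<T> f)"
  for X (structure)

text \<open>The bundles \<open>(p\<^sub>N, +\<^sub>N, 0\<^sub>N)\<close> and \<open>(T(p\<^sub>N), T(+\<^sub>N), T(0\<^sub>N))\<close>; for the latter, \<open>T(T\<^sub>2N)\<close> serves
  as the fibre product of \<open>T(p\<^sub>N)\<close> with itself.\<close>

definition tbundle :: "('o, 'a, 'm) tangent_scheme \<Rightarrow> 'o \<Rightarrow> 'a bundle_data" where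
  "tbundle X N = \<lparr>bproj = \<p> N, bpr = Tpr X 2 N, badd = \<oplus> N, bzero = \<zero> N\<rparr>"
  for X (structure)

definition Ttbundle :: "('o, 'a, 'm) tangent_scheme \<Rightarrow> 'o \<Rightarrow> 'a bundle_data" where
  "Ttbundle X N =
     \<lparr>bproj = \<T> (\<p> N), bpr = (\<lambda>i. \<T> (Tpr X 2 N i)), badd = \<T> (\<oplus> N), bzero = \<T> (\<zero> N)\<rparr>"
  for X (structure)

text \<open>
  For \<open>x, y : A \<rightarrow> T\<^sup>2N\<close> with \<open>x T(p\<^sub>N) = y T(p\<^sub>N)\<close>: the arrow \<open>(x, y) T(+\<^sub>N) : A \<rightarrow> T\<^sup>2N\<close>.
\<close>

definition Tadd :: "('o, 'a, 'm) tangent_scheme \<Rightarrow> 'o \<Rightarrow> 'a \<Rightarrow> 'a \<Rightarrow> 'a" where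
  "Tadd X N x y = pair X (\<T> (Tpr X 2 N 0)) (\<T> (Tpr X 2 N 1)) x y \<cdot> \<T> (\<oplus> N)"
  for X (structure)

locale tangent_category = category X
  for X :: "('o, 'a, 'm) tangent_scheme" (structure) +
  assumes TO_Ob: "A \<in> Ob X \<Longrightarrow> TO X A \<in> Ob X"
    and TA_hom: "f \<in> hom X A B \<Longrightarrow> \<T> f \<in> hom X (TO X A) (TO X B)"
    and TA_Ident: "A \<in> Ob X \<Longrightarrow> \<T> (\<one> A) = \<one> (TO X A)"
    and TA_Comp: "\<lbrakk>f \<in> hom X A B; g \<in> hom X B D\<rbrakk> \<Longrightarrow> \<T> (f \<cdot> g) = \<T> f \<cdot> \<T> g"
    and proj_nat: "nat_trans X (TO X) \<T> (\<lambda>A. A) (\<lambda>f. f) \<p>"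
    and zero_nat: "nat_trans X (\<lambda>A. A) (\<lambda>f. f) (TO X) \<T> \<zero>"
    and add_nat: "nat_trans X (TnO X 2) (T2A X) (TO X) \<T> \<oplus>"
    and lift_nat: "nat_trans X (TO X) \<T> (TO X \<circ> TO X) (\<T> \<circ> \<T>) \<l>"
    and flip_nat: "nat_trans X (TO X \<circ> TO X) (\<T> \<circ> \<T>) (TO X \<circ> TO X) (\<T> \<circ> \<T>) \<c>"
    and fibre_powers: "\<lbrakk>N \<in> Ob X; n \<ge> 1\<rbrakk> \<Longrightarrow>
      is_fibre_power X ((\<T> ^^ m) (\<p> N)) n ((TO X ^^ m) (TnO X n N)) (\<lambda>i. (\<T> ^^ m) (Tpr X n N i))"
    and additive: "N \<in> Ob X \<Longrightarrow> additive_bundle X (tbundle X N)"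
    and lift_additive: "N \<in> Ob X \<Longrightarrow>
      additive_bundle_hom X (tbundle X N) (Ttbundle X N) (\<l> N) (\<zero> N)"
    and flip_additive: "N \<in> Ob X \<Longrightarrow>
      additive_bundle_hom X (Ttbundle X N) (tbundle X (TO X N)) (\<c> N) (\<one> (TO X N))"
    and flip_flip: "N \<in> Ob X \<Longrightarrow> \<c> N \<cdot> \<c> N = \<one> (TO X (TO X N))"
    and lift_flip: "N \<in> Ob X \<Longrightarrow> \<l> N \<cdot> \<c> N = \<l> N"
    and lift_lift: "N \<in> Ob X \<Longrightarrow> \<l> N \<cdot> \<T> (\<l> N) = \<l> N \<cdot> \<l> (TO X N)"
    and flip_braid: "N \<in> Ob X \<Longrightarrow>
      \<T> (\<c> N) \<cdot> \<c> (TO X N) \<cdot> \<T> (\<c> N) = \<c> (TO X N) \<cdot> \<T> (\<c> N) \<cdot> \<c> (TO X N)"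
    and lift_flip_coherence: "N \<in> Ob X \<Longrightarrow>
      \<l> (TO X N) \<cdot> \<T> (\<c> N) \<cdot> \<c> (TO X N) = \<c> N \<cdot> \<T> (\<l> N)"
    and lift_universal: "N \<in> Ob X \<Longrightarrow>
      is_equaliser X (Tadd X N (Tpr X 2 N 0 \<cdot> \<l> N) (Tpr X 2 N 1 \<cdot> \<zero> (TO X N)))
        (\<T> (\<p> N)) (\<T> (\<p> N) \<cdot> \<p> N \<cdot> \<zero> N)"

record ('o, 'a) tangent_neg = "('o, 'a) tangent" +
  tneg :: "'o \<Rightarrow> 'a" ("\<ominus>\<index>")

locale tangent_category_with_negatives = tangent_category X
  for X :: "('o, 'a, 'm) tangent_neg_scheme" (structure) +
  assumes neg_nat: "nat_trans X (TO X) \<T> (TO X) \<T> \<ominus>"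
    and neg_proj: "N \<in> Ob X \<Longrightarrow> \<ominus> N \<cdot> \<p> N = \<p> N"
    and neg_inverse: "N \<in> Ob X \<Longrightarrow>
      pair X (Tpr X 2 N 0) (Tpr X 2 N 1) (\<one> (TO X N)) (\<ominus> N) \<cdot> \<oplus> N = \<p> N \<cdot> \<zero> N"

text \<open>Subtraction in the bundle \<open>p\<^sub>N\<close>, for \<open>x, y : A \<rightarrow> TN\<close> with \<open>x p\<^sub>N = y p\<^sub>N\<close>.\<close>

definition tsub :: "('o, 'a, 'm) tangent_neg_scheme \<Rightarrow> 'o \<Rightarrow> 'a \<Rightarrow> 'a \<Rightarrow> 'a" where
  "tsub X N x y = pair X (Tpr X 2 N 0) (Tpr X 2 N 1) x (y \<cdot> \<ominus> N) \<cdot> \<oplus> N"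
  for X (structure)

text \<open>The Lie bracket of vector fields \<open>V, W\<close> on \<open>N\<close>.\<close>

definition lie_bracket :: "('o, 'a, 'm) tangent_neg_scheme \<Rightarrow> 'o \<Rightarrow> 'a \<Rightarrow> 'a \<Rightarrow> 'a" where
  "lie_bracket X N V W =
     (THE u. u \<in> hom X N (TO X N) \<and> u \<cdot> \<p> N = \<one> N \<and>
        tsub X (TO X N) (V \<cdot> \<T> W) (W \<cdot> \<T> V \<cdot> \<c> N) = Tadd X N (u \<cdot> \<l> N) (W \<cdot> \<zero> (TO X N)))"
  for X (structure)

text \<open>
  A groupoid \<open>G \<rightrightarrows> M\<close>, together with chosen pullbacks
  \<open>cp0, cp1\<close> for \<open>G \<^sub>t\<times>\<^sub>s G\<close>, \<open>ios, pis\<close> for \<open>T\<^sup>sG\<close>, and \<open>act0, act1\<close> for \<open>G \<^sub>t\<times> T\<^sup>sG\<close> (over \<open>pis\<close>).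
\<close>

record ('o, 'a) groupoid =
  Garr :: 'o
  Gobj :: 'o
  gsrc :: 'a
  gtgt :: 'a
  gid :: 'a
  ginv :: 'a
  cp0 :: 'a
  cp1 :: 'a
  gmul :: 'a
  ios :: 'a
  pis :: 'a
  act0 :: 'a
  act1 :: 'a

text \<open>A pullback that exists and is preserved by \<open>T\<close>.\<close>

definition is_T_pullback :: "('o, 'a, 'm) tangent_scheme \<Rightarrow> 'a \<Rightarrow> 'a \<Rightarrow> 'a \<Rightarrow> 'a \<Rightarrow> bool" where
  "is_T_pullback X f g a b \<longleftrightarrow>
     is_pullback X f g a b \<and> is_pullback X (\<T> f) (\<T> g) (\<T> a) (\<T> b)"
  for X (structure)

text \<open>
  Associativity is stated on \<open>G\<^sub>3\<close>, the pullback of \<open>\<pi>\<^sub>1 t\<close> along \<open>s\<close>, with projections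
  \<open>\<rho>0\<close> to \<open>G\<^sub>2\<close> and \<open>\<rho>1\<close> to \<open>G\<close>.
\<close>

definition groupoid_in ::
  "('o, 'a, 'm) tangent_scheme \<Rightarrow> ('o, 'a) groupoid \<Rightarrow> bool" where
  "groupoid_in X \<G> \<longleftrightarrow>
     (let G = Garr \<G>; M = Gobj \<G>; s = gsrc \<G>; t = gtgt \<G>; e = gid \<G>; i = ginv \<G>; \<mu> = gmul \<G>;
          \<pi>0 = cp0 \<G>; \<pi>1 = cp1 \<G> in
        G \<in> Ob X \<and> M \<in> Ob X \<and>
        s \<in> hom X G M \<and> t \<in> hom X G M \<and> e \<in> hom X M G \<and> i \<in> hom X G G \<and>
        is_T_pullback X t s \<pi>0 \<pi>1 \<and> \<mu> \<in> hom X (Dom X \<pi>0) G \<and>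
        e \<cdot> s = \<one> M \<and> e \<cdot> t = \<one> M \<and> \<mu> \<cdot> s = \<pi>0 \<cdot> s \<and> \<mu> \<cdot> t = \<pi>1 \<cdot> t \<and>
        (\<exists>\<rho>0 \<rho>1. is_T_pullback X (\<pi>1 \<cdot> t) s \<rho>0 \<rho>1 \<and>
           pair X \<pi>0 \<pi>1 (\<rho>0 \<cdot> \<mu>) \<rho>1 \<cdot> \<mu> =
           pair X \<pi>0 \<pi>1 (\<rho>0 \<cdot> \<pi>0) (pair X \<pi>0 \<pi>1 (\<rho>0 \<cdot> \<pi>1) \<rho>1 \<cdot> \<mu>) \<cdot> \<mu>) \<and>
        pair X \<pi>0 \<pi>1 (s \<cdot> e) (\<one> G) \<cdot> \<mu> = \<one> G \<and> pair X \<pi>0 \<pi>1 (\<one> G) (t \<cdot> e) \<cdot> \<mu> = \<one> G \<and>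
        i \<cdot> s = t \<and> i \<cdot> t = s \<and>
        pair X \<pi>0 \<pi>1 (\<one> G) i \<cdot> \<mu> = s \<cdot> e \<and> pair X \<pi>0 \<pi>1 i (\<one> G) \<cdot> \<mu> = t \<cdot> e \<and>
        is_T_pullback X (\<T> s) (\<zero> M) (ios \<G>) (pis \<G>) \<and>
        is_T_pullback X t (pis \<G>) (act0 \<G>) (act1 \<G>))"
  for X (structure)

definition TsG :: "('o, 'a, 'm) tangent_scheme \<Rightarrow> ('o, 'a) groupoid \<Rightarrow> 'o" where
  "TsG X \<G> = Dom X (ios \<G>)"

definition ps :: "('o, 'a, 'm) tangent_scheme \<Rightarrow> ('o, 'a) groupoid \<Rightarrow> 'a" where
  "ps X \<G> = ios \<G> \<cdot> \<p> (Garr \<G>)"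
  for X (structure)

text \<open>The action \<open>\<mu>\<^sup>s\<close>; the pairing on the right lands in \<open>T(G \<^sub>t\<times>\<^sub>s G)\<close>.\<close>

definition mus :: "('o, 'a, 'm) tangent_scheme \<Rightarrow> ('o, 'a) groupoid \<Rightarrow> 'a" where
  "mus X \<G> =
     (THE m. m \<in> hom X (Dom X (act0 \<G>)) (TsG X \<G>) \<and>
        m \<cdot> ios \<G> =
          pair X (\<T> (cp0 \<G>)) (\<T> (cp1 \<G>)) (act0 \<G> \<cdot> \<zero> (Garr \<G>)) (act1 \<G> \<cdot> ios \<G>) \<cdot> \<T> (gmul \<G>) \<and>
        m \<cdot> pis \<G> = act0 \<G> \<cdot> gsrc \<G>)"
  for X (structure)

definition LeftInv :: "('o, 'a, 'm) tangent_scheme \<Rightarrow> ('o, 'a) groupoid \<Rightarrow> 'a set" where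
  "LeftInv X \<G> =
     {V \<in> hom X (Garr \<G>) (TsG X \<G>).
        V \<cdot> ps X \<G> = \<one> (Garr \<G>) \<and>
        pair X (act0 \<G>) (act1 \<G>) (cp0 \<G>) (cp1 \<G> \<cdot> V) \<cdot> mus X \<G> = gmul \<G> \<cdot> V}"
  for X (structure)

definition left_bracket ::
  "('o, 'a, 'm) tangent_neg_scheme \<Rightarrow> ('o, 'a) groupoid \<Rightarrow> 'a \<Rightarrow> 'a \<Rightarrow> 'a" where
  "left_bracket X \<G> V W =
     (THE Z. Z \<in> hom X (Garr \<G>) (TsG X \<G>) \<and>
        Z \<cdot> ios \<G> = lie_bracket X (Garr \<G>) (V \<cdot> ios \<G>) (W \<cdot> ios \<G>))"
  for X (structure)

end

theory Submission
  imports Defs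
begin

text \<open>
  The theorem is the classical fact that relatedness of vector fields is inherited by Lie brackets.
  Call vector fields \<open>V\<close> on \<open>N\<close> and \<open>V'\<close> on \<open>K\<close> related along \<open>\<phi> : N \<rightarrow> K\<close> if
  \<open>V T(\<phi>) = \<phi> V'\<close>. If \<open>V, V'\<close> and \<open>W, W'\<close> are related along \<open>\<phi>\<close>, then naturality of the flip and of
  the subtraction carries \<open>V T(W) - W T(V) c\<close> to \<open>V' T(W') - W' T(V') c\<close>, and naturality of the
  vertical lift, together with the fact that the vertical lift is monic, carries the bracket
  \<open>[V, W]\<close> to \<open>[V', W']\<close> (\<open>lie_bracket_related\<close>).

  A section \<open>X\<close> of \<open>p\<^sup>s\<close> corresponds to a vector field \<open>V = X \<iota>\<^sup>s\<close> on \<open>G\<close> related to \<open>0\<close> along the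
  source map. Such a \<open>V\<close> prolongs to the vector field \<open>(\<pi>\<^sub>0 0, \<pi>\<^sub>1 V)\<close> on the object \<open>G\<^sub>2\<close> of
  composable pairs, which is the only one related to \<open>0\<close> along \<open>\<pi>\<^sub>0\<close> and to \<open>V\<close> along \<open>\<pi>\<^sub>1\<close>. Left
  invariance of \<open>X\<close> says exactly that this prolongation is related to \<open>V\<close> along the multiplication
  (\<open>LeftInv_iff\<close>). Since \<open>[0, 0] = 0\<close> (\<open>lie_bracket_zero\<close>), the bracket of the prolongations of
  \<open>V\<close> and \<open>W\<close> is again related to \<open>0\<close> along \<open>\<pi>\<^sub>0\<close> and to \<open>[V, W]\<close> along \<open>\<pi>\<^sub>1\<close>, so it is the
  prolongation of \<open>[V, W]\<close>; and it is related to \<open>[V, W]\<close> along the multiplication. Hence \<open>[V, W]\<close>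
  is left invariant (\<open>left_invariant_lie_bracket\<close>).
\<close>

section \<open>Composition and pullbacks\<close>

text \<open>
  Membership in a hom-set unfolds to statements about \<open>Ar\<close>, \<open>Dom\<close> and \<open>Cod\<close>, so that the simplifier
  can compute the types of composites and thereby discharge the side conditions of associativity.
\<close>

lemma hom_iff [simp]: "f \<in> hom C A B \<longleftrightarrow> f \<in> Ar C \<and> Dom C f = A \<and> Cod C f = B"
  by (simp add: hom_def)

context category
begin

lemma Ob_Dom_Cod [simp]: "f \<in> Ar C \<Longrightarrow> Dom C f \<in> Ob C" "f \<in> Ar C \<Longrightarrow> Cod C f \<in> Ob C"
  by (simp_all add: Dom_Ob Cod_Ob)

lemma Ident_typing [simp]:
  assumes "A \<in> Ob C"
  shows "\<one> A \<in> Ar C" "Dom C (\<one> A) = A" "Cod C (\<one> A) = A"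
  using Ident_hom[OF assms] by simp_all

lemma Comp_typing [simp]:
  assumes "f \<in> Ar C" "g \<in> Ar C" "Cod C f = Dom C g"
  shows "f \<cdot> g \<in> Ar C" "Dom C (f \<cdot> g) = Dom C f" "Cod C (f \<cdot> g) = Cod C g"
  using Comp_hom[of f "Dom C f" "Dom C g" g "Cod C g"] assms by simp_all

lemma Comp_Ident [simp]:
  "\<lbrakk>f \<in> Ar C; Dom C f = A\<rbrakk> \<Longrightarrow> \<one> A \<cdot> f = f"
  "\<lbrakk>f \<in> Ar C; Cod C f = A\<rbrakk> \<Longrightarrow> f \<cdot> \<one> A = f"
  using Ident_left Ident_right by auto

lemma assoc [simp]:
  "\<lbrakk>f \<in> Ar C; g \<in> Ar C; h \<in> Ar C; Cod C f = Dom C g; Cod C g = Dom C h\<rbrakk>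
    \<Longrightarrow> (f \<cdot> g) \<cdot> h = f \<cdot> (g \<cdot> h)"
  using Comp_assoc by auto

text \<open>
  Composites are normalised to the right, where an equation between composites of two arrows no
  longer applies literally; this rule supplies its form under a further composition.
\<close>

lemma Comp_extend:
  assumes "f \<cdot> g = k" "f \<in> Ar C" "g \<in> Ar C" "h \<in> Ar C" "Cod C f = Dom C g" "Cod C g = Dom C h"
  shows "f \<cdot> (g \<cdot> h) = k \<cdot> h"
  using assms by (simp flip: assoc)

lemma pullback_typing:
  assumes "is_pullback C f g a b"
  shows "f \<in> Ar C" "g \<in> Ar C" "a \<in> Ar C" "b \<in> Ar C" "Cod C g = Cod C f" "Cod C a = Dom C f"
    "Dom C b = Dom C a" "Cod C b = Dom C g" "a \<cdot> f = b \<cdot> g"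
  using assms unfolding is_pullback_def by auto

lemma pair_unique:
  assumes "is_pullback C f g a b" "h \<in> hom C Q (Dom C f)" "k \<in> hom C Q (Dom C g)" "h \<cdot> f = k \<cdot> g"
  shows "\<exists>!u. u \<in> hom C Q (Dom C a) \<and> u \<cdot> a = h \<and> u \<cdot> b = k"
proof -
  have "Q \<in> Ob C" using assms(2) by auto
  then show ?thesis using assms unfolding is_pullback_def by blast
qed

lemma pair:
  assumes "is_pullback C f g a b" "h \<in> hom C Q (Dom C f)" "k \<in> hom C Q (Dom C g)" "h \<cdot> f = k \<cdot> g"
  shows "pair C a b h k \<in> hom C Q (Dom C a)"
    and "pair C a b h k \<cdot> a = h" and "pair C a b h k \<cdot> b = k"
  using theI'[OF pair_unique[OF assms]] assms(2) unfolding pair_def by auto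

lemma pullback_eqI:
  assumes "is_pullback C f g a b" "u \<in> hom C Q (Dom C a)" "v \<in> hom C Q (Dom C a)"
    "u \<cdot> a = v \<cdot> a" "u \<cdot> b = v \<cdot> b"
  shows "u = v"
proof -
  note [simp] = pullback_typing[OF assms(1)]
  have "\<exists>!w. w \<in> hom C Q (Dom C a) \<and> w \<cdot> a = v \<cdot> a \<and> w \<cdot> b = v \<cdot> b"
    by (rule pair_unique[OF assms(1)]) (use assms(3) in simp_all)
  then show ?thesis using assms(2-5) by metis
qed

lemma Comp_pair:
  assumes "is_pullback C f g a b" "h \<in> hom C Q (Dom C f)" "k \<in> hom C Q (Dom C g)" "h \<cdot> f = k \<cdot> g"
    and "r \<in> hom C R Q"
  shows "r \<cdot> pair C a b h k = pair C a b (r \<cdot> h) (r \<cdot> k)"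
proof -
  note [simp] = pullback_typing[OF assms(1)]
  note p = pair[OF assms(1-4)]
  have q: "pair C a b (r \<cdot> h) (r \<cdot> k) \<in> hom C R (Dom C a)"
    "pair C a b (r \<cdot> h) (r \<cdot> k) \<cdot> a = r \<cdot> h" "pair C a b (r \<cdot> h) (r \<cdot> k) \<cdot> b = r \<cdot> k"
    by (rule pair[OF assms(1)]; use assms(2-5) in simp)+
  show ?thesis
    by (rule pullback_eqI[OF assms(1) _ q(1)]) (use p q assms(5) in auto)
qed

lemma pair_proj:
  assumes "is_pullback C f g a b" "u \<in> hom C Q (Dom C a)"
  shows "pair C a b (u \<cdot> a) (u \<cdot> b) = u"
proof -
  note [simp] = pullback_typing[OF assms(1)]
  have q: "pair C a b (u \<cdot> a) (u \<cdot> b) \<in> hom C Q (Dom C a)"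
    "pair C a b (u \<cdot> a) (u \<cdot> b) \<cdot> a = u \<cdot> a" "pair C a b (u \<cdot> a) (u \<cdot> b) \<cdot> b = u \<cdot> b"
    by (rule pair[OF assms(1)]; use assms(2) in simp)+
  show ?thesis by (rule pullback_eqI[OF assms(1) q(1) assms(2) q(2,3)])
qed

text \<open>Treating \<open>T\<^sub>2N\<close> as a pullback makes the arrows into it instances of \<open>pair\<close>.\<close>

lemma fibre_power_pullback:
  assumes fp: "is_fibre_power C q 2 P \<pi>"
  shows "is_pullback C q q (\<pi> 0) (\<pi> 1)" "Dom C (\<pi> 0) = P"
proof -
  have two: "(\<forall>i<2. S i) \<longleftrightarrow> S 0 \<and> S (1::nat)" for S
    by (auto simp: less_2_cases_iff)
  have t: "q \<in> Ar C" "\<pi> 0 \<in> hom C P (Dom C q)" "\<pi> 1 \<in> hom C P (Dom C q)"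
    "\<pi> 0 \<cdot> q = \<pi> 1 \<cdot> q"
    using fp unfolding is_fibre_power_def by simp_all
  then show d: "Dom C (\<pi> 0) = P" by simp
  have ex: "\<exists>!u. u \<in> hom C Q P \<and> u \<cdot> \<pi> 0 = h \<and> u \<cdot> \<pi> 1 = k"
    if h: "Q \<in> Ob C" "h \<in> hom C Q (Dom C q)" "k \<in> hom C Q (Dom C q)" "h \<cdot> q = k \<cdot> q" for Q h k
  proof -
    define g where "g = (\<lambda>i::nat. if i = 0 then h else k)"
    have "\<forall>h :: nat \<Rightarrow> 'a.
        (\<forall>i<2. h i \<in> hom C Q (Dom C q)) \<and> (\<forall>i<2. \<forall>j<2. h i \<cdot> q = h j \<cdot> q) \<longrightarrow>
        (\<exists>!u. u \<in> hom C Q P \<and> (\<forall>i<2. u \<cdot> \<pi> i = h i))"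
      using fp h(1) unfolding is_fibre_power_def by (elim conjE) (rule bspec)
    then have "(\<forall>i<2. g i \<in> hom C Q (Dom C q)) \<and> (\<forall>i<2. \<forall>j<2. g i \<cdot> q = g j \<cdot> q) \<longrightarrow>
        (\<exists>!u. u \<in> hom C Q P \<and> (\<forall>i<2. u \<cdot> \<pi> i = g i))"
      by (rule spec)
    moreover have "(\<forall>i<2. g i \<in> hom C Q (Dom C q)) \<and> (\<forall>i<2. \<forall>j<2. g i \<cdot> q = g j \<cdot> q)"
      using h by (simp add: g_def)
    ultimately have "\<exists>!u. u \<in> hom C Q P \<and> (\<forall>i<2. u \<cdot> \<pi> i = g i)" by (rule mp)
    then show ?thesis unfolding two by (simp add: g_def)
  qed
  show "is_pullback C q q (\<pi> 0) (\<pi> 1)"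
    unfolding is_pullback_def d
    by (intro conjI ballI impI ex) (use t in simp_all)
qed

end

section \<open>Naturality and additive bundles\<close>

context tangent_category
begin

lemma TO_in_Ob [simp]: "N \<in> Ob X \<Longrightarrow> TO X N \<in> Ob X"
  by (rule TO_Ob)

lemma T_typing [simp]:
  assumes "f \<in> Ar X"
  shows "\<T> f \<in> Ar X" "Dom X (\<T> f) = TO X (Dom X f)" "Cod X (\<T> f) = TO X (Cod X f)"
  using TA_hom[of f "Dom X f" "Cod X f"] assms by simp_all

lemma T_Comp [simp]:
  "\<lbrakk>f \<in> Ar X; g \<in> Ar X; Cod X f = Dom X g\<rbrakk> \<Longrightarrow> \<T> (f \<cdot> g) = \<T> f \<cdot> \<T> g"
  using TA_Comp[of f "Dom X f" "Cod X f" g "Cod X g"] by simp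

lemma T_Ident [simp]: "N \<in> Ob X \<Longrightarrow> \<T> (\<one> N) = \<one> (TO X N)"
  by (rule TA_Ident)

lemma structure_typing [simp]:
  assumes "N \<in> Ob X"
  shows "\<p> N \<in> Ar X" "Dom X (\<p> N) = TO X N" "Cod X (\<p> N) = N"
    "\<zero> N \<in> Ar X" "Dom X (\<zero> N) = N" "Cod X (\<zero> N) = TO X N"
    "\<oplus> N \<in> Ar X" "Dom X (\<oplus> N) = TnO X 2 N" "Cod X (\<oplus> N) = TO X N"
    "\<l> N \<in> Ar X" "Dom X (\<l> N) = TO X N" "Cod X (\<l> N) = TO X (TO X N)"
    "\<c> N \<in> Ar X" "Dom X (\<c> N) = TO X (TO X N)" "Cod X (\<c> N) = TO X (TO X N)"
  using proj_nat zero_nat add_nat lift_nat flip_nat assms unfolding nat_trans_def by auto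

lemma proj_natural: "\<lbrakk>f \<in> Ar X; Cod X f = B\<rbrakk> \<Longrightarrow> \<T> f \<cdot> \<p> B = \<p> (Dom X f) \<cdot> f"
  using proj_nat unfolding nat_trans_def by auto

lemma zero_natural: "\<lbrakk>f \<in> Ar X; Dom X f = A\<rbrakk> \<Longrightarrow> \<zero> A \<cdot> \<T> f = f \<cdot> \<zero> (Cod X f)"
  using zero_nat unfolding nat_trans_def by auto

lemma lift_natural: "\<lbrakk>f \<in> Ar X; Dom X f = A\<rbrakk> \<Longrightarrow> \<l> A \<cdot> \<T> (\<T> f) = \<T> f \<cdot> \<l> (Cod X f)"
  using lift_nat unfolding nat_trans_def by auto

lemma flip_natural:
  "\<lbrakk>f \<in> Ar X; Dom X f = A\<rbrakk> \<Longrightarrow> \<c> A \<cdot> \<T> (\<T> f) = \<T> (\<T> f) \<cdot> \<c> (Cod X f)"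
  using flip_nat unfolding nat_trans_def by auto

lemma zero_proj: "N \<in> Ob X \<Longrightarrow> \<zero> N \<cdot> \<p> N = \<one> N"
  using additive[of N] unfolding additive_bundle_def tbundle_def Let_def by auto

lemma lift_Tproj: "N \<in> Ob X \<Longrightarrow> \<l> N \<cdot> \<T> (\<p> N) = \<p> N \<cdot> \<zero> N"
  using lift_additive[of N] unfolding additive_bundle_hom_def tbundle_def Ttbundle_def by auto

lemma zero_lift: "N \<in> Ob X \<Longrightarrow> \<zero> N \<cdot> \<l> N = \<zero> N \<cdot> \<T> (\<zero> N)"
  using lift_additive[of N] unfolding additive_bundle_hom_def tbundle_def Ttbundle_def by auto

lemma flip_proj: "N \<in> Ob X \<Longrightarrow> \<c> N \<cdot> \<p> (TO X N) = \<T> (\<p> N)"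
  using flip_additive[of N] unfolding additive_bundle_hom_def tbundle_def Ttbundle_def by auto

lemma Tzero_flip: "N \<in> Ob X \<Longrightarrow> \<T> (\<zero> N) \<cdot> \<c> N = \<zero> (TO X N)"
  using flip_additive[of N] unfolding additive_bundle_hom_def tbundle_def Ttbundle_def by auto

text \<open>
  The flip carries \<open>T(p)\<close> to \<open>p\<close> as part of a bundle morphism; being an involution that fixes the
  lift, it also carries \<open>p\<close> to \<open>T(p)\<close>, and the lift lies over the zero section for both projections.
\<close>

lemma flip_Tproj:
  assumes "N \<in> Ob X"
  shows "\<c> N \<cdot> \<T> (\<p> N) = \<p> (TO X N)"
  using Comp_extend[OF flip_flip[OF assms], of "\<p> (TO X N)"] flip_proj[OF assms] assms by simp

lemma lift_proj:
  assumes "N \<in> Ob X"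
  shows "\<l> N \<cdot> \<p> (TO X N) = \<p> N \<cdot> \<zero> N"
  using Comp_extend[OF lift_flip[OF assms], of "\<p> (TO X N)"]
    flip_proj[OF assms] lift_Tproj[OF assms] assms by simp

lemma T2_pullback:
  assumes "N \<in> Ob X"
  shows "is_pullback X (\<p> N) (\<p> N) (Tpr X 2 N 0) (Tpr X 2 N 1)"
    and "is_pullback X (\<T> (\<p> N)) (\<T> (\<p> N)) (\<T> (Tpr X 2 N 0)) (\<T> (Tpr X 2 N 1))"
  using fibre_power_pullback[OF fibre_powers[OF assms, of 2 0, simplified]]
    fibre_power_pullback[OF fibre_powers[OF assms, of 2 1, simplified]] by simp_all

lemma Tpr_typing [simp]:
  assumes "N \<in> Ob X"
  shows "Tpr X 2 N 0 \<in> Ar X" "Dom X (Tpr X 2 N 0) = TnO X 2 N" "Cod X (Tpr X 2 N 0) = TO X N"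
    "Tpr X 2 N (Suc 0) \<in> Ar X" "Dom X (Tpr X 2 N (Suc 0)) = TnO X 2 N"
    "Cod X (Tpr X 2 N (Suc 0)) = TO X N"
    "TnO X 2 N \<in> Ob X"
  using fibre_powers[OF assms, of 2 0] assms
  unfolding is_fibre_power_def by (auto simp: less_2_cases_iff)

text \<open>The sum \<open>(x, y) +\<^sub>N\<close> of generalised elements, the counterpart of \<open>Tadd\<close> for the bundle \<open>p\<^sub>N\<close>.\<close>

definition tplus :: "'o \<Rightarrow> 'a \<Rightarrow> 'a \<Rightarrow> 'a" where
  "tplus N x y = pair X (Tpr X 2 N 0) (Tpr X 2 N 1) x y \<cdot> \<oplus> N"

lemma T2_pair:
  assumes "N \<in> Ob X" "x \<in> hom X A (TO X N)" "y \<in> hom X A (TO X N)" "x \<cdot> \<p> N = y \<cdot> \<p> N"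
  defines "h \<equiv> pair X (Tpr X 2 N 0) (Tpr X 2 N 1) x y"
  shows "h \<in> Ar X" "Dom X h = A" "Cod X h = TnO X 2 N"
    "h \<cdot> Tpr X 2 N 0 = x" "h \<cdot> Tpr X 2 N (Suc 0) = y"
  using pair[OF T2_pullback(1)[OF assms(1)], of x A y] assms by auto

lemma TT2_pair:
  assumes "N \<in> Ob X" "x \<in> hom X A (TO X (TO X N))" "y \<in> hom X A (TO X (TO X N))"
    "x \<cdot> \<T> (\<p> N) = y \<cdot> \<T> (\<p> N)"
  defines "h \<equiv> pair X (\<T> (Tpr X 2 N 0)) (\<T> (Tpr X 2 N 1)) x y"
  shows "h \<in> Ar X" "Dom X h = A" "Cod X h = TO X (TnO X 2 N)"
    "h \<cdot> \<T> (Tpr X 2 N 0) = x" "h \<cdot> \<T> (Tpr X 2 N (Suc 0)) = y"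
  using pair[OF T2_pullback(2)[OF assms(1)], of x A y] assms by auto

lemma tplus_typing:
  assumes "N \<in> Ob X" "x \<in> hom X A (TO X N)" "y \<in> hom X A (TO X N)" "x \<cdot> \<p> N = y \<cdot> \<p> N"
  shows "tplus N x y \<in> Ar X" "Dom X (tplus N x y) = A" "Cod X (tplus N x y) = TO X N"
  using T2_pair[OF assms] assms(1) unfolding tplus_def by simp_all

lemma Tadd_typing:
  assumes "N \<in> Ob X" "x \<in> hom X A (TO X (TO X N))" "y \<in> hom X A (TO X (TO X N))"
    "x \<cdot> \<T> (\<p> N) = y \<cdot> \<T> (\<p> N)"
  shows "Tadd X N x y \<in> Ar X" "Dom X (Tadd X N x y) = A"
    "Cod X (Tadd X N x y) = TO X (TO X N)"
  using TT2_pair[OF assms] assms(1) unfolding Tadd_def by simp_all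

lemma Comp_tplus:
  assumes "N \<in> Ob X" "x \<in> hom X A (TO X N)" "y \<in> hom X A (TO X N)" "x \<cdot> \<p> N = y \<cdot> \<p> N"
    and "r \<in> hom X B A"
  shows "r \<cdot> tplus N x y = tplus N (r \<cdot> x) (r \<cdot> y)"
proof -
  have "r \<cdot> tplus N x y = (r \<cdot> pair X (Tpr X 2 N 0) (Tpr X 2 N 1) x y) \<cdot> \<oplus> N"
    using T2_pair[OF assms(1-4)] assms(1,5) unfolding tplus_def by simp
  also have "r \<cdot> pair X (Tpr X 2 N 0) (Tpr X 2 N 1) x y
      = pair X (Tpr X 2 N 0) (Tpr X 2 N 1) (r \<cdot> x) (r \<cdot> y)"
    by (rule Comp_pair[OF T2_pullback(1)[OF assms(1)]]) (use assms in simp_all)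
  finally show ?thesis unfolding tplus_def .
qed

lemma Comp_Tadd:
  assumes "N \<in> Ob X" "x \<in> hom X A (TO X (TO X N))" "y \<in> hom X A (TO X (TO X N))"
    "x \<cdot> \<T> (\<p> N) = y \<cdot> \<T> (\<p> N)" and "r \<in> hom X B A"
  shows "r \<cdot> Tadd X N x y = Tadd X N (r \<cdot> x) (r \<cdot> y)"
proof -
  have "r \<cdot> Tadd X N x y = (r \<cdot> pair X (\<T> (Tpr X 2 N 0)) (\<T> (Tpr X 2 N 1)) x y) \<cdot> \<T> (\<oplus> N)"
    using TT2_pair[OF assms(1-4)] assms(1,5) unfolding Tadd_def by simp
  also have "r \<cdot> pair X (\<T> (Tpr X 2 N 0)) (\<T> (Tpr X 2 N 1)) x y
      = pair X (\<T> (Tpr X 2 N 0)) (\<T> (Tpr X 2 N 1)) (r \<cdot> x) (r \<cdot> y)"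
    by (rule Comp_pair[OF T2_pullback(2)[OF assms(1)]]) (use assms in simp_all)
  finally show ?thesis unfolding Tadd_def .
qed

text \<open>
  These are the defining equations of \<open>T\<^sub>2(f)\<close>, which depend on \<open>T(f)\<close> lying over \<open>f\<close>.
\<close>

lemma T2A_typing:
  assumes "f \<in> Ar X"
  shows "T2A X f \<in> Ar X" "Dom X (T2A X f) = TnO X 2 (Dom X f)"
    "Cod X (T2A X f) = TnO X 2 (Cod X f)"
    "T2A X f \<cdot> Tpr X 2 (Cod X f) 0 = Tpr X 2 (Dom X f) 0 \<cdot> \<T> f"
    "T2A X f \<cdot> Tpr X 2 (Cod X f) (Suc 0) = Tpr X 2 (Dom X f) (Suc 0) \<cdot> \<T> f"
proof -
  have e: "Tpr X 2 (Dom X f) 0 \<cdot> \<p> (Dom X f) = Tpr X 2 (Dom X f) (Suc 0) \<cdot> \<p> (Dom X f)"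
    using pullback_typing(9)[OF T2_pullback(1)[of "Dom X f"]] assms by simp
  have "(Tpr X 2 (Dom X f) 0 \<cdot> \<T> f) \<cdot> \<p> (Cod X f)
      = (Tpr X 2 (Dom X f) (Suc 0) \<cdot> \<T> f) \<cdot> \<p> (Cod X f)"
    using assms Comp_extend[OF e, of f] by (simp add: proj_natural)
  then show "T2A X f \<in> Ar X" "Dom X (T2A X f) = TnO X 2 (Dom X f)"
    "Cod X (T2A X f) = TnO X 2 (Cod X f)"
    "T2A X f \<cdot> Tpr X 2 (Cod X f) 0 = Tpr X 2 (Dom X f) 0 \<cdot> \<T> f"
    "T2A X f \<cdot> Tpr X 2 (Cod X f) (Suc 0) = Tpr X 2 (Dom X f) (Suc 0) \<cdot> \<T> f"
    using T2_pair[of "Cod X f" "Tpr X 2 (Dom X f) 0 \<cdot> \<T> f" "TnO X 2 (Dom X f)"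
        "Tpr X 2 (Dom X f) 1 \<cdot> \<T> f"] assms
    unfolding T2A_def by simp_all
qed

lemma add_natural: "f \<in> Ar X \<Longrightarrow> T2A X f \<cdot> \<oplus> (Cod X f) = \<oplus> (Dom X f) \<cdot> \<T> f"
  using add_nat unfolding nat_trans_def by auto

text \<open>Naturality of \<open>+\<close> says that \<open>T(f)\<close> is additive on fibres.\<close>

lemma tplus_T:
  assumes "x \<in> hom X A (TO X N)" "y \<in> hom X A (TO X N)" "x \<cdot> \<p> N = y \<cdot> \<p> N"
    and f: "f \<in> hom X N K"
  shows "tplus N x y \<cdot> \<T> f = tplus K (x \<cdot> \<T> f) (y \<cdot> \<T> f)"
proof -
  have N: "N \<in> Ob X" "K \<in> Ob X" using f by auto
  let ?h = "pair X (Tpr X 2 N 0) (Tpr X 2 N 1) x y"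
  note [simp] = T2_pair[OF N(1) assms(1-3), simplified] T2A_typing[of f]
  have "tplus N x y \<cdot> \<T> f = ?h \<cdot> (T2A X f \<cdot> \<oplus> K)"
    using N f add_natural[of f] unfolding tplus_def by auto
  also have "\<dots> = (?h \<cdot> T2A X f) \<cdot> \<oplus> K"
    using N f by auto
  also have "?h \<cdot> T2A X f = pair X (Tpr X 2 K 0) (Tpr X 2 K 1) (x \<cdot> \<T> f) (y \<cdot> \<T> f)"
  proof -
    have "(?h \<cdot> T2A X f) \<cdot> Tpr X 2 K 0 = x \<cdot> \<T> f"
      using N f T2A_typing(4)[of f] Comp_extend[of ?h "Tpr X 2 N 0" x "\<T> f"] by auto
    moreover have "(?h \<cdot> T2A X f) \<cdot> Tpr X 2 K 1 = y \<cdot> \<T> f"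
      using N f T2A_typing(5)[of f] Comp_extend[of ?h "Tpr X 2 N 1" y "\<T> f"] by auto
    moreover have "?h \<cdot> T2A X f \<in> hom X A (Dom X (Tpr X 2 K 0))"
      using N f by auto
    ultimately show ?thesis
      using pair_proj[OF T2_pullback(1)[OF N(2)], of "?h \<cdot> T2A X f" A] by simp
  qed
  finally show ?thesis unfolding tplus_def .
qed

text \<open>The image under \<open>T\<close> of naturality of \<open>+\<close>: \<open>T\<^sup>2(f)\<close> is additive for the bundles \<open>T(p)\<close>.\<close>

lemma Tadd_TT:
  assumes "x \<in> hom X A (TO X (TO X N))" "y \<in> hom X A (TO X (TO X N))"
    "x \<cdot> \<T> (\<p> N) = y \<cdot> \<T> (\<p> N)"
    and f: "f \<in> hom X N K"
  shows "Tadd X N x y \<cdot> \<T> (\<T> f) = Tadd X K (x \<cdot> \<T> (\<T> f)) (y \<cdot> \<T> (\<T> f))"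
proof -
  have N: "N \<in> Ob X" "K \<in> Ob X" using f by auto
  let ?h = "pair X (\<T> (Tpr X 2 N 0)) (\<T> (Tpr X 2 N 1)) x y"
  note [simp] = TT2_pair[OF N(1) assms(1-3), simplified] T2A_typing[of f]
  have "\<T> (T2A X f) \<cdot> \<T> (\<oplus> K) = \<T> (\<oplus> N) \<cdot> \<T> (\<T> f)"
    using arg_cong[OF add_natural[of f], of \<T>] N f by auto
  then have "Tadd X N x y \<cdot> \<T> (\<T> f) = ?h \<cdot> (\<T> (T2A X f) \<cdot> \<T> (\<oplus> K))"
    using N f unfolding Tadd_def by auto
  also have "\<dots> = (?h \<cdot> \<T> (T2A X f)) \<cdot> \<T> (\<oplus> K)"
    using N f by auto
  also have "?h \<cdot> \<T> (T2A X f)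
      = pair X (\<T> (Tpr X 2 K 0)) (\<T> (Tpr X 2 K 1)) (x \<cdot> \<T> (\<T> f)) (y \<cdot> \<T> (\<T> f))"
  proof -
    have t: "\<T> (T2A X f) \<cdot> \<T> (Tpr X 2 K 0) = \<T> (Tpr X 2 N 0) \<cdot> \<T> (\<T> f)"
      "\<T> (T2A X f) \<cdot> \<T> (Tpr X 2 K 1) = \<T> (Tpr X 2 N 1) \<cdot> \<T> (\<T> f)"
      using T2A_typing(4,5)[of f] N f by (auto simp flip: T_Comp)
    have "(?h \<cdot> \<T> (T2A X f)) \<cdot> \<T> (Tpr X 2 K 0) = x \<cdot> \<T> (\<T> f)"
      using N f t(1) Comp_extend[of ?h "\<T> (Tpr X 2 N 0)" x "\<T> (\<T> f)"] by auto
    moreover have "(?h \<cdot> \<T> (T2A X f)) \<cdot> \<T> (Tpr X 2 K 1) = y \<cdot> \<T> (\<T> f)"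
      using N f t(2) Comp_extend[of ?h "\<T> (Tpr X 2 N 1)" y "\<T> (\<T> f)"] by auto
    moreover have "?h \<cdot> \<T> (T2A X f) \<in> hom X A (Dom X (\<T> (Tpr X 2 K 0)))"
      using N f by auto
    ultimately show ?thesis
      using pair_proj[OF T2_pullback(2)[OF N(2)], of "?h \<cdot> \<T> (T2A X f)" A] by simp
  qed
  finally show ?thesis unfolding Tadd_def .
qed

text \<open>
  Naturality of \<open>p\<close> at \<open>+\<^sub>N\<close> shows that \<open>p\<^sub>T\<^sub>N\<close> is itself additive from the bundle \<open>T(p\<^sub>N)\<close> to \<open>p\<^sub>N\<close>.
\<close>

lemma Tadd_proj:
  assumes N: "N \<in> Ob X" and "x \<in> hom X A (TO X (TO X N))" "y \<in> hom X A (TO X (TO X N))"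
    "x \<cdot> \<T> (\<p> N) = y \<cdot> \<T> (\<p> N)"
  shows "Tadd X N x y \<cdot> \<p> (TO X N) = tplus N (x \<cdot> \<p> (TO X N)) (y \<cdot> \<p> (TO X N))"
proof -
  let ?h = "pair X (\<T> (Tpr X 2 N 0)) (\<T> (Tpr X 2 N 1)) x y" and ?p = "\<p> (TnO X 2 N)"
  note [simp] = TT2_pair[OF assms, simplified]
  have "Tadd X N x y \<cdot> \<p> (TO X N) = (?h \<cdot> ?p) \<cdot> \<oplus> N"
    using N unfolding Tadd_def by (simp add: proj_natural)
  also have "?h \<cdot> ?p
      = pair X (Tpr X 2 N 0) (Tpr X 2 N 1) (x \<cdot> \<p> (TO X N)) (y \<cdot> \<p> (TO X N))"
  proof -
    have "(?h \<cdot> ?p) \<cdot> Tpr X 2 N 0 = x \<cdot> \<p> (TO X N)"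
      using N proj_natural[of "Tpr X 2 N 0" "TO X N"]
        Comp_extend[of ?h "\<T> (Tpr X 2 N 0)" x "\<p> (TO X N)"] by simp
    moreover have "(?h \<cdot> ?p) \<cdot> Tpr X 2 N 1 = y \<cdot> \<p> (TO X N)"
      using N proj_natural[of "Tpr X 2 N 1" "TO X N"]
        Comp_extend[of ?h "\<T> (Tpr X 2 N 1)" y "\<p> (TO X N)"] by simp
    ultimately show ?thesis
      using pair_proj[OF T2_pullback(1)[OF N], of "?h \<cdot> ?p" A] N by simp
  qed
  finally show ?thesis unfolding tplus_def .
qed

lemma tplus_zero_right:
  assumes N: "N \<in> Ob X" and x: "x \<in> hom X A (TO X N)"
  shows "tplus N x (x \<cdot> \<p> N \<cdot> \<zero> N) = x"
proof -
  have "tplus N (\<one> (TO X N)) (\<p> N \<cdot> \<zero> N) = \<one> (TO X N)"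
    using additive[OF N] N unfolding additive_bundle_def tbundle_def tplus_def Let_def by simp
  moreover have "x \<cdot> tplus N (\<one> (TO X N)) (\<p> N \<cdot> \<zero> N)
      = tplus N (x \<cdot> \<one> (TO X N)) (x \<cdot> (\<p> N \<cdot> \<zero> N))"
    by (rule Comp_tplus) (use N x in \<open>simp_all add: zero_proj\<close>)
  ultimately show ?thesis using N x by simp
qed

lemma tplus_commute:
  assumes N: "N \<in> Ob X" and xy: "x \<in> hom X A (TO X N)" "y \<in> hom X A (TO X N)"
    "x \<cdot> \<p> N = y \<cdot> \<p> N"
  shows "tplus N x y = tplus N y x"
proof -
  let ?h = "pair X (Tpr X 2 N 0) (Tpr X 2 N 1) x y"
  note [simp] = T2_pair[OF assms, simplified]
  have e: "Tpr X 2 N 0 \<cdot> \<p> N = Tpr X 2 N (Suc 0) \<cdot> \<p> N"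
    using pullback_typing(9)[OF T2_pullback(1)[OF N]] by simp
  have "tplus N (Tpr X 2 N 1) (Tpr X 2 N 0) = \<oplus> N"
    using additive[OF N] unfolding additive_bundle_def tbundle_def tplus_def Let_def by simp
  then have "tplus N x y = ?h \<cdot> tplus N (Tpr X 2 N 1) (Tpr X 2 N 0)"
    unfolding tplus_def[of N x y] by simp
  also have "\<dots> = tplus N (?h \<cdot> Tpr X 2 N 1) (?h \<cdot> Tpr X 2 N 0)"
    by (rule Comp_tplus) (use N e in simp_all)
  finally show ?thesis by simp
qed

lemma tplus_proj:
  assumes N: "N \<in> Ob X" and "x \<in> hom X A (TO X N)" "y \<in> hom X A (TO X N)"
    "x \<cdot> \<p> N = y \<cdot> \<p> N"
  shows "tplus N x y \<cdot> \<p> N = x \<cdot> \<p> N"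
proof -
  note [simp] = T2_pair[OF assms, simplified]
  have "\<oplus> N \<cdot> \<p> N = Tpr X 2 N 0 \<cdot> \<p> N"
    using additive[OF N] unfolding additive_bundle_def tbundle_def Let_def by simp
  then show ?thesis
    using N Comp_extend[of "pair X (Tpr X 2 N 0) (Tpr X 2 N 1) x y" "Tpr X 2 N 0" x "\<p> N"]
    unfolding tplus_def by simp
qed

lemma T_tplus:
  assumes N: "N \<in> Ob X" and "x \<in> hom X A (TO X N)" "y \<in> hom X A (TO X N)"
    "x \<cdot> \<p> N = y \<cdot> \<p> N"
  shows "\<T> (tplus N x y) = Tadd X N (\<T> x) (\<T> y)"
proof -
  let ?h = "pair X (Tpr X 2 N 0) (Tpr X 2 N 1) x y"
  note h = T2_pair[OF assms, simplified]
  have "\<T> ?h \<cdot> \<T> (Tpr X 2 N 0) = \<T> x" "\<T> ?h \<cdot> \<T> (Tpr X 2 N (Suc 0)) = \<T> y"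
    using arg_cong[OF h(4), of \<T>] arg_cong[OF h(5), of \<T>] h(1-3) N by simp_all
  then have "\<T> ?h = pair X (\<T> (Tpr X 2 N 0)) (\<T> (Tpr X 2 N 1)) (\<T> x) (\<T> y)"
    using pair_proj[OF T2_pullback(2)[OF N], of "\<T> ?h" "TO X A"] h(1-3) N by simp
  then show ?thesis
    using h(1-3) N unfolding tplus_def Tadd_def by simp
qed

section \<open>The vertical lift\<close>

text \<open>
  The arrow that the universal property makes an equaliser, applied to the generalised element
  \<open>(u, w)\<close> of \<open>T\<^sub>2N\<close>: the tangent vector, based at \<open>w\<close>, of the line \<open>w + \<epsilon> u\<close> in the fibre.
\<close>

definition vlift :: "'o \<Rightarrow> 'a \<Rightarrow> 'a \<Rightarrow> 'a" where
  "vlift N u w = Tadd X N (u \<cdot> \<l> N) (w \<cdot> \<zero> (TO X N))"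

lemma vlift_pairable:
  assumes N: "N \<in> Ob X" and "u \<in> hom X A (TO X N)" "w \<in> hom X A (TO X N)"
    "u \<cdot> \<p> N = w \<cdot> \<p> N"
  shows "u \<cdot> \<l> N \<in> hom X A (TO X (TO X N))" "w \<cdot> \<zero> (TO X N) \<in> hom X A (TO X (TO X N))"
    "(u \<cdot> \<l> N) \<cdot> \<T> (\<p> N) = (w \<cdot> \<zero> (TO X N)) \<cdot> \<T> (\<p> N)"
  using assms Comp_extend[OF assms(4), of "\<zero> N"]
  by (simp_all add: lift_Tproj zero_natural)

text \<open>
  Since \<open>u \<l>\<close> projects to a zero vector and \<open>w 0\<close> projects to \<open>w\<close>, the sum of the two projects
  to the base point \<open>w\<close>.
\<close>

lemma vlift_proj:
  assumes N: "N \<in> Ob X" and u: "u \<in> hom X A (TO X N)" and w: "w \<in> hom X A (TO X N)"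
    and e: "u \<cdot> \<p> N = w \<cdot> \<p> N"
  shows "vlift N u w \<cdot> \<p> (TO X N) = w"
proof -
  have "vlift N u w \<cdot> \<p> (TO X N) = tplus N (w \<cdot> \<p> N \<cdot> \<zero> N) w"
    unfolding vlift_def using Tadd_proj[OF N vlift_pairable[OF assms]] N u w
      Comp_extend[OF e, of "\<zero> N"] by (simp add: lift_proj zero_proj)
  also have "\<dots> = tplus N w (w \<cdot> \<p> N \<cdot> \<zero> N)"
    by (rule tplus_commute[OF N]) (use N w in \<open>simp_all add: zero_proj\<close>)
  finally show ?thesis using tplus_zero_right[OF N w] by simp
qed

lemma Comp_vlift:
  assumes "N \<in> Ob X" "u \<in> hom X A (TO X N)" "w \<in> hom X A (TO X N)" "u \<cdot> \<p> N = w \<cdot> \<p> N"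
    and "r \<in> hom X B A"
  shows "r \<cdot> vlift N u w = vlift N (r \<cdot> u) (r \<cdot> w)"
  using Comp_Tadd[OF assms(1) vlift_pairable[OF assms(1-4)] assms(5)] assms
  unfolding vlift_def by simp

lemma vlift_TT:
  assumes "u \<in> hom X A (TO X N)" "w \<in> hom X A (TO X N)" "u \<cdot> \<p> N = w \<cdot> \<p> N"
    and f: "f \<in> hom X N K"
  shows "vlift N u w \<cdot> \<T> (\<T> f) = vlift K (u \<cdot> \<T> f) (w \<cdot> \<T> f)"
proof -
  have N: "N \<in> Ob X" "K \<in> Ob X" using f by auto
  show ?thesis
    using Tadd_TT[OF vlift_pairable[OF N(1) assms(1-3)] f] assms N
    unfolding vlift_def by (simp add: lift_natural zero_natural)
qed

lemma vlift_equaliser: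
  assumes N: "N \<in> Ob X"
  shows "is_equaliser X (vlift N (Tpr X 2 N 0) (Tpr X 2 N 1)) (\<T> (\<p> N)) (\<T> (\<p> N) \<cdot> \<p> N \<cdot> \<zero> N)"
    "Dom X (vlift N (Tpr X 2 N 0) (Tpr X 2 N 1)) = TnO X 2 N"
proof -
  show "is_equaliser X (vlift N (Tpr X 2 N 0) (Tpr X 2 N 1)) (\<T> (\<p> N)) (\<T> (\<p> N) \<cdot> \<p> N \<cdot> \<zero> N)"
    using lift_universal[OF N] unfolding vlift_def .
  have e: "Tpr X 2 N 0 \<cdot> \<p> N = Tpr X 2 N (Suc 0) \<cdot> \<p> N"
    using pullback_typing(9)[OF T2_pullback(1)[OF N]] by simp
  show "Dom X (vlift N (Tpr X 2 N 0) (Tpr X 2 N 1)) = TnO X 2 N"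
    unfolding vlift_def
    by (rule Tadd_typing(2)[OF N vlift_pairable[OF N]]) (use N e in simp_all)
qed

lemma Comp_vlift_Tpr:
  assumes N: "N \<in> Ob X" and h: "h \<in> hom X A (TnO X 2 N)"
  shows "h \<cdot> vlift N (Tpr X 2 N 0) (Tpr X 2 N 1) = vlift N (h \<cdot> Tpr X 2 N 0) (h \<cdot> Tpr X 2 N 1)"
proof -
  have e: "Tpr X 2 N 0 \<cdot> \<p> N = Tpr X 2 N (Suc 0) \<cdot> \<p> N"
    using pullback_typing(9)[OF T2_pullback(1)[OF N]] by simp
  show ?thesis by (rule Comp_vlift) (use N h e in simp_all)
qed

text \<open>An equaliser is monic, and \<open>u\<close> is a component of the arrow into \<open>T\<^sub>2N\<close>.\<close>

lemma vlift_inject: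
  assumes N: "N \<in> Ob X" and u: "u \<in> hom X A (TO X N)" "v \<in> hom X A (TO X N)"
    and w: "w \<in> hom X A (TO X N)" and e: "u \<cdot> \<p> N = w \<cdot> \<p> N" "v \<cdot> \<p> N = w \<cdot> \<p> N"
    and eq: "vlift N u w = vlift N v w"
  shows "u = v"
proof -
  let ?k = "vlift N (Tpr X 2 N 0) (Tpr X 2 N 1)"
  let ?u = "pair X (Tpr X 2 N 0) (Tpr X 2 N 1) u w" and ?v = "pair X (Tpr X 2 N 0) (Tpr X 2 N 1) v w"
  note [simp] = T2_pair[OF N u(1) w e(1), simplified] T2_pair[OF N u(2) w e(2), simplified]
  note k = vlift_equaliser[OF N]
  have "\<exists>!m. m \<in> hom X A (Dom X ?k) \<and> m \<cdot> ?k = ?u \<cdot> ?k"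
  proof -
    have "A \<in> Ob X" using u by auto
    moreover have "?u \<cdot> ?k \<in> hom X A (Dom X (\<T> (\<p> N)))"
      using k N unfolding is_equaliser_def by (simp)
    moreover have "(?u \<cdot> ?k) \<cdot> \<T> (\<p> N) = (?u \<cdot> ?k) \<cdot> (\<T> (\<p> N) \<cdot> \<p> N \<cdot> \<zero> N)"
      using k N unfolding is_equaliser_def by simp
    ultimately show ?thesis using k(1) unfolding is_equaliser_def by blast
  qed
  moreover have "?u \<cdot> ?k = ?v \<cdot> ?k"
    using eq Comp_vlift_Tpr[OF N, of ?u A] Comp_vlift_Tpr[OF N, of ?v A] by simp
  moreover have "?u \<in> hom X A (Dom X ?k)" "?v \<in> hom X A (Dom X ?k)" using k(2) by simp_all
  ultimately have "?u = ?v" by metis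
  then have "?u \<cdot> Tpr X 2 N 0 = ?v \<cdot> Tpr X 2 N 0" by (simp only:)
  then show ?thesis by simp
qed

text \<open>
  The other half of the universal property; the second component of the induced arrow into \<open>T\<^sub>2N\<close>
  is identified by \<open>vlift_proj\<close>.
\<close>

lemma vlift_surj:
  assumes N: "N \<in> Ob X" and f: "f \<in> hom X A (TO X (TO X N))"
    and e: "f \<cdot> \<T> (\<p> N) = f \<cdot> \<T> (\<p> N) \<cdot> \<p> N \<cdot> \<zero> N"
  obtains u where "u \<in> hom X A (TO X N)" "u \<cdot> \<p> N = f \<cdot> \<p> (TO X N) \<cdot> \<p> N"
    "f = vlift N u (f \<cdot> \<p> (TO X N))"
proof -
  let ?k = "vlift N (Tpr X 2 N 0) (Tpr X 2 N 1)"
  note k = vlift_equaliser[OF N]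
  have "\<exists>!m. m \<in> hom X A (Dom X ?k) \<and> m \<cdot> ?k = f"
  proof -
    have "A \<in> Ob X" using f by auto
    moreover have "f \<in> hom X A (Dom X (\<T> (\<p> N)))" using N f by simp
    moreover have "f \<cdot> \<T> (\<p> N) = f \<cdot> (\<T> (\<p> N) \<cdot> \<p> N \<cdot> \<zero> N)" using N f e by simp
    ultimately show ?thesis using k(1) unfolding is_equaliser_def by blast
  qed
  then obtain m where m: "m \<in> hom X A (TnO X 2 N)" "m \<cdot> ?k = f" using k(2) by auto
  let ?u = "m \<cdot> Tpr X 2 N 0" and ?w = "m \<cdot> Tpr X 2 N 1"
  have uw: "?u \<in> hom X A (TO X N)" "?w \<in> hom X A (TO X N)" "?u \<cdot> \<p> N = ?w \<cdot> \<p> N"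
    using m N pullback_typing(9)[OF T2_pullback(1)[OF N]] by simp_all
  have fu: "f = vlift N ?u ?w" using m Comp_vlift_Tpr[OF N m(1)] by simp
  then have w: "f \<cdot> \<p> (TO X N) = ?w" using vlift_proj[OF N uw] by simp
  show ?thesis
    by (rule that[of ?u]) (use uw fu w in \<open>simp_all del: assoc\<close>)
qed

section \<open>Vector fields and their brackets\<close>

definition vector_field :: "'o \<Rightarrow> 'a \<Rightarrow> bool" where
  "vector_field N V \<longleftrightarrow> N \<in> Ob X \<and> V \<in> hom X N (TO X N) \<and> V \<cdot> \<p> N = \<one> N"

definition related :: "'a \<Rightarrow> 'a \<Rightarrow> 'a \<Rightarrow> bool" where
  "related \<phi> V W \<longleftrightarrow> V \<cdot> \<T> \<phi> = \<phi> \<cdot> W"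

lemma vector_field_zero: "N \<in> Ob X \<Longrightarrow> vector_field N (\<zero> N)"
  unfolding vector_field_def by (simp add: zero_proj)

end

context tangent_category_with_negatives
begin

lemma neg_typing [simp]:
  "N \<in> Ob X \<Longrightarrow> \<ominus> N \<in> Ar X" "N \<in> Ob X \<Longrightarrow> Dom X (\<ominus> N) = TO X N"
  "N \<in> Ob X \<Longrightarrow> Cod X (\<ominus> N) = TO X N"
  using neg_nat unfolding nat_trans_def by auto

lemma neg_natural: "\<lbrakk>f \<in> Ar X; Dom X f = A\<rbrakk> \<Longrightarrow> \<ominus> A \<cdot> \<T> f = \<T> f \<cdot> \<ominus> (Cod X f)"
  using neg_nat unfolding nat_trans_def by auto

lemma tsub_tplus: "tsub X N x y = tplus N x (y \<cdot> \<ominus> N)"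
  unfolding tsub_def tplus_def ..

lemma tsub_pairable:
  assumes "N \<in> Ob X" "x \<in> hom X A (TO X N)" "y \<in> hom X A (TO X N)" "x \<cdot> \<p> N = y \<cdot> \<p> N"
  shows "y \<cdot> \<ominus> N \<in> hom X A (TO X N)" "x \<cdot> \<p> N = (y \<cdot> \<ominus> N) \<cdot> \<p> N"
  using assms by (simp_all add: neg_proj)

lemma tsub_typing:
  assumes "N \<in> Ob X" "x \<in> hom X A (TO X N)" "y \<in> hom X A (TO X N)" "x \<cdot> \<p> N = y \<cdot> \<p> N"
  shows "tsub X N x y \<in> hom X A (TO X N)"
  using tplus_typing[OF assms(1,2) tsub_pairable[OF assms]] unfolding tsub_tplus by simp

lemma tsub_proj:
  assumes "N \<in> Ob X" "x \<in> hom X A (TO X N)" "y \<in> hom X A (TO X N)" "x \<cdot> \<p> N = y \<cdot> \<p> N"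
  shows "tsub X N x y \<cdot> \<p> N = x \<cdot> \<p> N"
  using tplus_proj[OF assms(1,2) tsub_pairable[OF assms]] unfolding tsub_tplus .

lemma Comp_tsub:
  assumes "N \<in> Ob X" "x \<in> hom X A (TO X N)" "y \<in> hom X A (TO X N)" "x \<cdot> \<p> N = y \<cdot> \<p> N"
    and "r \<in> hom X B A"
  shows "r \<cdot> tsub X N x y = tsub X N (r \<cdot> x) (r \<cdot> y)"
  using Comp_tplus[OF assms(1,2) tsub_pairable[OF assms(1-4)] assms(5)] assms
  unfolding tsub_tplus by simp

lemma tsub_T:
  assumes "x \<in> hom X A (TO X N)" "y \<in> hom X A (TO X N)" "x \<cdot> \<p> N = y \<cdot> \<p> N"
    and f: "f \<in> hom X N K"
  shows "tsub X N x y \<cdot> \<T> f = tsub X K (x \<cdot> \<T> f) (y \<cdot> \<T> f)"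
proof -
  have "N \<in> Ob X" "K \<in> Ob X" using f by auto
  then show ?thesis
    using tplus_T[OF assms(1) tsub_pairable[OF _ assms(1-3)] f] assms
    unfolding tsub_tplus by (simp add: neg_natural)
qed

lemma tsub_self:
  assumes N: "N \<in> Ob X" and x: "x \<in> hom X A (TO X N)"
  shows "tsub X N x x = x \<cdot> \<p> N \<cdot> \<zero> N"
proof -
  have "x \<cdot> tsub X N (\<one> (TO X N)) (\<one> (TO X N)) = tsub X N (x \<cdot> \<one> (TO X N)) (x \<cdot> \<one> (TO X N))"
    by (rule Comp_tsub) (use N x in simp_all)
  moreover have "tsub X N (\<one> (TO X N)) (\<one> (TO X N)) = \<p> N \<cdot> \<zero> N"
    using neg_inverse[OF N] N unfolding tsub_def by simp
  ultimately show ?thesis using N x by simp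
qed

text \<open>The arrow \<open>f\<close> whose vertical part \<open>{f}\<close> is the bracket \<open>[V, W]\<close>.\<close>

definition commutator :: "'o \<Rightarrow> 'a \<Rightarrow> 'a \<Rightarrow> 'a" where
  "commutator N V W = tsub X (TO X N) (V \<cdot> \<T> W) (W \<cdot> \<T> V \<cdot> \<c> N)"

lemma commutator_pairable:
  assumes "vector_field N V" "vector_field N W"
  shows "V \<cdot> \<T> W \<in> hom X N (TO X (TO X N))" "W \<cdot> \<T> V \<cdot> \<c> N \<in> hom X N (TO X (TO X N))"
    "(V \<cdot> \<T> W) \<cdot> \<p> (TO X N) = W" "(W \<cdot> \<T> V \<cdot> \<c> N) \<cdot> \<p> (TO X N) = W"
    "(V \<cdot> \<T> W) \<cdot> \<T> (\<p> N) = V" "(W \<cdot> \<T> V \<cdot> \<c> N) \<cdot> \<T> (\<p> N) = V"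
proof -
  have N: "N \<in> Ob X" and V: "V \<in> hom X N (TO X N)" "V \<cdot> \<p> N = \<one> N"
    and W: "W \<in> hom X N (TO X N)" "W \<cdot> \<p> N = \<one> N"
    using assms unfolding vector_field_def by auto
  have T: "\<T> V \<cdot> \<T> (\<p> N) = \<one> (TO X N)" "\<T> W \<cdot> \<T> (\<p> N) = \<one> (TO X N)"
    using N V W T_Comp[of V "\<p> N"] T_Comp[of W "\<p> N"] by auto
  show "V \<cdot> \<T> W \<in> hom X N (TO X (TO X N))" "W \<cdot> \<T> V \<cdot> \<c> N \<in> hom X N (TO X (TO X N))"
    "(V \<cdot> \<T> W) \<cdot> \<p> (TO X N) = W" "(W \<cdot> \<T> V \<cdot> \<c> N) \<cdot> \<p> (TO X N) = W"
    "(V \<cdot> \<T> W) \<cdot> \<T> (\<p> N) = V" "(W \<cdot> \<T> V \<cdot> \<c> N) \<cdot> \<T> (\<p> N) = V"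
    using N V W T Comp_extend[OF V(2), of W] Comp_extend[OF W(2), of V]
    by (simp_all add: proj_natural flip_proj flip_Tproj)
qed

text \<open>
  Both terms of the difference lie over \<open>W\<close> along \<open>p\<close> and over \<open>V\<close> along \<open>T(p)\<close>. The second makes
  the commutator vertical: \<open>T(p)\<close> is additive and sends the difference to \<open>V - V\<close>.
\<close>

lemma commutator:
  assumes "vector_field N V" "vector_field N W"
  shows "commutator N V W \<in> hom X N (TO X (TO X N))" "commutator N V W \<cdot> \<p> (TO X N) = W"
    "commutator N V W \<cdot> \<T> (\<p> N) = \<zero> N"
proof -
  note vf = assms[unfolded vector_field_def]
  note p = commutator_pairable[OF assms]
  have N: "N \<in> Ob X" "TO X N \<in> Ob X" using vf by auto
  have e: "(V \<cdot> \<T> W) \<cdot> \<p> (TO X N) = (W \<cdot> \<T> V \<cdot> \<c> N) \<cdot> \<p> (TO X N)" using p by metis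
  show "commutator N V W \<in> hom X N (TO X (TO X N))"
    unfolding commutator_def by (rule tsub_typing[OF N(2) p(1,2) e])
  show "commutator N V W \<cdot> \<p> (TO X N) = W"
    unfolding commutator_def using tsub_proj[OF N(2) p(1,2) e] p(3) by metis
  have "commutator N V W \<cdot> \<T> (\<p> N) = tsub X N V V"
    unfolding commutator_def using tsub_T[OF p(1,2) e, of "\<p> N" N] p(5,6) N by simp
  also have "\<dots> = (V \<cdot> \<p> N) \<cdot> \<zero> N" using tsub_self[OF N(1), of V N] vf N by simp
  finally show "commutator N V W \<cdot> \<T> (\<p> N) = \<zero> N" using vf by simp
qed

lemma lie_bracket_ex1:
  assumes "vector_field N V" "vector_field N W"
  shows "\<exists>!u. u \<in> hom X N (TO X N) \<and> u \<cdot> \<p> N = \<one> N \<and> commutator N V W = vlift N u W"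
proof -
  note vf = assms[unfolded vector_field_def]
  have N: "N \<in> Ob X" using vf by auto
  note c = commutator[OF assms]
  have "commutator N V W \<cdot> \<T> (\<p> N) = commutator N V W \<cdot> \<T> (\<p> N) \<cdot> \<p> N \<cdot> \<zero> N"
    using c N by (simp add: zero_proj)
  from vlift_surj[OF N c(1) this] obtain u where
    "u \<in> hom X N (TO X N)" "u \<cdot> \<p> N = \<one> N" "commutator N V W = vlift N u W"
    using c(2) vf by metis
  moreover have "u = v" if "u \<in> hom X N (TO X N)" "u \<cdot> \<p> N = \<one> N" "commutator N V W = vlift N u W"
    "v \<in> hom X N (TO X N)" "v \<cdot> \<p> N = \<one> N" "commutator N V W = vlift N v W" for u v
    by (rule vlift_inject[OF N, of u N v W]) (use that vf in auto)
  ultimately show ?thesis by blast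
qed

lemma lie_bracket:
  assumes "vector_field N V" "vector_field N W"
  shows "vector_field N (lie_bracket X N V W)"
    and "commutator N V W = vlift N (lie_bracket X N V W) W"
  using theI'[OF lie_bracket_ex1[OF assms]] assms
  unfolding lie_bracket_def commutator_def vlift_def vector_field_def by auto

lemma lie_bracket_eqI:
  assumes "vector_field N V" "vector_field N W" "vector_field N u" "commutator N V W = vlift N u W"
  shows "lie_bracket X N V W = u"
  using lie_bracket_ex1[OF assms(1,2)] lie_bracket[OF assms(1,2)] assms(3,4)
  unfolding vector_field_def by blast

text \<open>
  Both sides of the equation defining the bracket equal the zero \<open>0\<^sub>N T(0\<^sub>N) = 0\<^sub>N 0\<^sub>T\<^sub>N\<close> of \<open>T\<^sup>2N\<close>: the commutator is the
  difference of this arrow with itself, and the vertical lift is its sum with itself along \<open>T(p\<^sub>N)\<close>.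
\<close>

lemma lie_bracket_zero:
  assumes N: "N \<in> Ob X"
  shows "lie_bracket X N (\<zero> N) (\<zero> N) = \<zero> N"
proof (rule lie_bracket_eqI)
  have z: "\<zero> N \<cdot> \<T> (\<zero> N) = \<zero> N \<cdot> \<zero> (TO X N)" using N by (simp add: zero_natural)
  have zc: "\<zero> N \<cdot> \<T> (\<zero> N) \<cdot> \<c> N = \<zero> N \<cdot> \<zero> (TO X N)" using N by (simp add: Tzero_flip)
  have "commutator N (\<zero> N) (\<zero> N) = tsub X (TO X N) (\<zero> N \<cdot> \<zero> (TO X N)) (\<zero> N \<cdot> \<zero> (TO X N))"
    unfolding commutator_def zc by (simp only: z)
  also have "\<dots> = \<zero> N \<cdot> \<zero> (TO X N)"
    using tsub_self[of "TO X N" "\<zero> N \<cdot> \<zero> (TO X N)" N] N zero_proj[of "TO X N"]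
      Comp_extend[OF zero_proj, of "TO X N"]
    by simp
  finally have c: "commutator N (\<zero> N) (\<zero> N) = \<zero> N \<cdot> \<zero> (TO X N)" .
  have "tplus N (\<zero> N) (\<zero> N) = \<zero> N"
    using tplus_zero_right[OF N, of "\<zero> N" N] Comp_extend[OF zero_proj[OF N], of "\<zero> N"] N by simp
  then have T: "Tadd X N (\<T> (\<zero> N)) (\<T> (\<zero> N)) = \<T> (\<zero> N)"
    using T_tplus[OF N, of "\<zero> N" N "\<zero> N"] N by simp
  have "vlift N (\<zero> N) (\<zero> N) = Tadd X N (\<zero> N \<cdot> \<T> (\<zero> N)) (\<zero> N \<cdot> \<T> (\<zero> N))"
    unfolding vlift_def using N z by (simp add: zero_lift)
  also have "\<dots> = \<zero> N \<cdot> \<T> (\<zero> N)"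
    using Comp_Tadd[of N "\<T> (\<zero> N)" "TO X N" "\<T> (\<zero> N)" "\<zero> N" N] T N by simp
  finally show "commutator N (\<zero> N) (\<zero> N) = vlift N (\<zero> N) (\<zero> N)"
    using c z by simp
qed (use N in \<open>simp_all add: vector_field_zero\<close>)

text \<open>
  Everything in the definition of the bracket is natural, so \<open>T\<^sup>2(\<phi>)\<close> takes the commutator on \<open>N\<close> to
  \<open>\<phi>\<close> followed by the commutator on \<open>K\<close>. Both are vertical lifts at \<open>\<phi> W'\<close>, so
  \<open>vlift_inject\<close> compares the brackets.
\<close>

lemma lie_bracket_related:
  assumes V: "vector_field N V" "vector_field K V'" "related \<phi> V V'"
    and W: "vector_field N W" "vector_field K W'" "related \<phi> W W'"
    and \<phi>: "\<phi> \<in> hom X N K"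
  shows "related \<phi> (lie_bracket X N V W) (lie_bracket X K V' W')"
proof -
  let ?u = "lie_bracket X N V W" and ?u' = "lie_bracket X K V' W'"
  note vf = V[unfolded vector_field_def related_def] W[unfolded vector_field_def related_def]
  note u = lie_bracket[OF V(1) W(1)] and u' = lie_bracket[OF V(2) W(2)]
  note ut = u(1)[unfolded vector_field_def] u'(1)[unfolded vector_field_def]
  note p = commutator_pairable[OF V(1) W(1)] and p' = commutator_pairable[OF V(2) W(2)]
  have e: "(V \<cdot> \<T> W) \<cdot> \<p> (TO X N) = (W \<cdot> \<T> V \<cdot> \<c> N) \<cdot> \<p> (TO X N)" using p by metis
  have e': "(V' \<cdot> \<T> W') \<cdot> \<p> (TO X K) = (W' \<cdot> \<T> V' \<cdot> \<c> K) \<cdot> \<p> (TO X K)" using p' by metis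
  have NK: "N \<in> Ob X" "K \<in> Ob X" using vf by auto
  have T: "\<T> V \<cdot> \<T> (\<T> \<phi>) = \<T> \<phi> \<cdot> \<T> V'" "\<T> W \<cdot> \<T> (\<T> \<phi>) = \<T> \<phi> \<cdot> \<T> W'"
    using vf \<phi> T_Comp[of V "\<T> \<phi>"] T_Comp[of W "\<T> \<phi>"] by auto
  have VW: "V \<cdot> \<T> W \<cdot> \<T> (\<T> \<phi>) = \<phi> \<cdot> (V' \<cdot> \<T> W')"
    using vf \<phi> NK T Comp_extend[of V "\<T> \<phi>" "\<phi> \<cdot> V'" "\<T> W'"] by auto
  have "(W \<cdot> \<T> V \<cdot> \<c> N) \<cdot> \<T> (\<T> \<phi>) = W \<cdot> (\<T> V \<cdot> \<T> (\<T> \<phi>)) \<cdot> \<c> K"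
    using vf \<phi> NK by (auto simp: flip_natural)
  also have "\<dots> = \<phi> \<cdot> (W' \<cdot> \<T> V' \<cdot> \<c> K)"
    using vf \<phi> NK T Comp_extend[of W "\<T> \<phi>" "\<phi> \<cdot> W'" "\<T> V' \<cdot> \<c> K"] by auto
  finally have WV: "(W \<cdot> \<T> V \<cdot> \<c> N) \<cdot> \<T> (\<T> \<phi>) = \<phi> \<cdot> (W' \<cdot> \<T> V' \<cdot> \<c> K)" .
  \<comment> \<open>The two terms of the commutator on \<open>N\<close> are now known to map to those on \<open>K\<close>.\<close>
  have "vlift K (?u \<cdot> \<T> \<phi>) (\<phi> \<cdot> W') = vlift N ?u W \<cdot> \<T> (\<T> \<phi>)"
    using vlift_TT[of ?u N N W \<phi> K] ut vf \<phi> by simp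
  also have "\<dots> = commutator N V W \<cdot> \<T> (\<T> \<phi>)" using u by simp
  also have "\<dots> = tsub X (TO X K) (\<phi> \<cdot> (V' \<cdot> \<T> W')) (\<phi> \<cdot> (W' \<cdot> \<T> V' \<cdot> \<c> K))"
    using tsub_T[OF p(1,2) e, of "\<T> \<phi>" "TO X K"] VW WV \<phi> unfolding commutator_def by simp
  also have "\<dots> = \<phi> \<cdot> commutator K V' W'"
    unfolding commutator_def
    by (rule Comp_tsub[OF _ p'(1,2) e', symmetric]) (use NK \<phi> in simp_all)
  also have "\<dots> = vlift K (\<phi> \<cdot> ?u') (\<phi> \<cdot> W')"
    using Comp_vlift[of K ?u' K W' \<phi> N] u'(2) ut vf \<phi> by simp
  finally show ?thesis
    unfolding related_def
    by (rule vlift_inject[OF NK(2), rotated -1])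
      (use ut vf \<phi> NK Comp_extend[of ?u "\<p> N" "\<one> N" \<phi>] in \<open>auto simp: proj_natural\<close>)
qed

end

section \<open>Left invariant vector fields on a groupoid\<close>

locale internal_groupoid = tangent_category_with_negatives X
  for X :: "('o, 'a, 'm) tangent_neg_scheme" (structure) +
  fixes \<G> :: "('o, 'a) groupoid"
  assumes groupoid: "groupoid_in X \<G>"
begin

abbreviation "G \<equiv> Garr \<G>"
abbreviation "M \<equiv> Gobj \<G>"
abbreviation "src \<equiv> gsrc \<G>"
abbreviation "tgt \<equiv> gtgt \<G>"
abbreviation "\<mu> \<equiv> gmul \<G>"
abbreviation "\<pi>0 \<equiv> cp0 \<G>"
abbreviation "\<pi>1 \<equiv> cp1 \<G>"
abbreviation "G2 \<equiv> Dom X \<pi>0"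
abbreviation "\<iota> \<equiv> ios \<G>"
abbreviation "\<pi>\<^sub>s \<equiv> pis \<G>"

lemma pullbacks:
  shows comp_pullback: "is_pullback X tgt src \<pi>0 \<pi>1"
    and T_comp_pullback: "is_pullback X (\<T> tgt) (\<T> src) (\<T> \<pi>0) (\<T> \<pi>1)"
    and TsG_pullback: "is_pullback X (\<T> src) (\<zero> M) \<iota> \<pi>\<^sub>s"
    and act_pullback: "is_pullback X tgt \<pi>\<^sub>s (act0 \<G>) (act1 \<G>)"
  using groupoid unfolding groupoid_in_def is_T_pullback_def Let_def by simp_all

lemma groupoid_typing [simp]:
  "G \<in> Ob X" "M \<in> Ob X" "src \<in> Ar X" "Dom X src = G" "Cod X src = M"
  "tgt \<in> Ar X" "Dom X tgt = G" "Cod X tgt = M" "\<mu> \<in> Ar X" "Dom X \<mu> = G2" "Cod X \<mu> = G"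
  using groupoid unfolding groupoid_in_def Let_def by simp_all

lemma mul_src: "\<mu> \<cdot> src = \<pi>0 \<cdot> src"
  using groupoid unfolding groupoid_in_def Let_def by simp

lemma proj_typing [simp]:
  "\<pi>0 \<in> Ar X" "Cod X \<pi>0 = G" "\<pi>1 \<in> Ar X" "Dom X \<pi>1 = G2" "Cod X \<pi>1 = G"
  "\<iota> \<in> Ar X" "Cod X \<iota> = TO X G" "\<pi>\<^sub>s \<in> Ar X" "Dom X \<pi>\<^sub>s = Dom X \<iota>" "Cod X \<pi>\<^sub>s = M"
  "act0 \<G> \<in> Ar X" "Cod X (act0 \<G>) = G" "act1 \<G> \<in> Ar X"
  "Dom X (act1 \<G>) = Dom X (act0 \<G>)" "Cod X (act1 \<G>) = Dom X \<iota>"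
  using pullback_typing[OF comp_pullback] pullback_typing[OF TsG_pullback]
    pullback_typing[OF act_pullback] by simp_all

lemma composable: "\<pi>0 \<cdot> tgt = \<pi>1 \<cdot> src"
  and TsG_square: "\<iota> \<cdot> \<T> src = \<pi>\<^sub>s \<cdot> \<zero> M"
  and act_square: "act0 \<G> \<cdot> tgt = act1 \<G> \<cdot> \<pi>\<^sub>s"
  using pullback_typing(9)[OF comp_pullback] pullback_typing(9)[OF TsG_pullback]
    pullback_typing(9)[OF act_pullback] by simp_all

text \<open>
  The zero section is a split monic with retraction \<open>p\<close>, so the projection \<open>\<pi>\<^sup>s\<close> is determined by
  \<open>\<iota>\<^sup>s\<close>; in particular \<open>\<iota>\<^sup>s\<close> is monic.
\<close>

lemma TsG_base:
  assumes "Z \<in> hom X A (Dom X \<iota>)"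
  shows "Z \<cdot> \<pi>\<^sub>s = Z \<cdot> \<iota> \<cdot> \<p> G \<cdot> src"
proof -
  have "\<pi>\<^sub>s = \<pi>\<^sub>s \<cdot> (\<zero> M \<cdot> \<p> M)" by (simp add: zero_proj)
  also have "\<dots> = (\<iota> \<cdot> \<T> src) \<cdot> \<p> M" by (simp only: TsG_square) simp
  also have "\<dots> = \<iota> \<cdot> \<p> G \<cdot> src" by (simp add: proj_natural)
  finally show ?thesis using assms by simp
qed

lemma TsG_monic:
  assumes "u \<in> hom X A (Dom X \<iota>)" "v \<in> hom X A (Dom X \<iota>)" "u \<cdot> \<iota> = v \<cdot> \<iota>"
  shows "u = v"
  by (rule pullback_eqI[OF TsG_pullback assms]) (simp only: TsG_base[OF assms(1)] TsG_base[OF assms(2)] assms(3))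

text \<open>
  The vector field on composable pairs \<open>(g, h)\<close> that keeps \<open>g\<close> fixed and moves \<open>h\<close> along \<open>V\<close>.
  Composability to first order requires \<open>h\<close> to move inside its source fibre, that is,
  \<open>V\<close> to be related to \<open>0\<close> along the source.
\<close>

definition prolong :: "'a \<Rightarrow> 'a" where
  "prolong V = pair X (\<T> \<pi>0) (\<T> \<pi>1) (\<pi>0 \<cdot> \<zero> G) (\<pi>1 \<cdot> V)"

definition left_invariant :: "'a \<Rightarrow> bool" where
  "left_invariant V \<longleftrightarrow>
     vector_field G V \<and> related src V (\<zero> M) \<and> related \<mu> (prolong V) V"

text \<open>
  The two required components are compatible since \<open>\<pi>\<^sub>0 t = \<pi>\<^sub>1 s\<close>. As \<open>T\<close> preserves the pullback of
  composable pairs, they determine an arrow into \<open>T(G\<^sub>2)\<close>, and the only one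
  (\<open>prolong_unique\<close>).
\<close>

lemma prolong:
  assumes V: "vector_field G V" "related src V (\<zero> M)"
  shows "vector_field G2 (prolong V)" "related \<pi>0 (prolong V) (\<zero> G)" "related \<pi>1 (prolong V) V"
proof -
  have v [simp]: "V \<in> Ar X" "Dom X V = G" "Cod X V = TO X G" "V \<cdot> \<p> G = \<one> G"
    "V \<cdot> \<T> src = src \<cdot> \<zero> M"
    using V unfolding vector_field_def related_def by simp_all
  have "(\<pi>0 \<cdot> \<zero> G) \<cdot> \<T> tgt = (\<pi>1 \<cdot> V) \<cdot> \<T> src"
    using Comp_extend[OF composable, of "\<zero> M"] by (simp add: zero_natural)
  then have h: "prolong V \<in> hom X G2 (TO X G2)" "prolong V \<cdot> \<T> \<pi>0 = \<pi>0 \<cdot> \<zero> G"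
    "prolong V \<cdot> \<T> \<pi>1 = \<pi>1 \<cdot> V"
    using pair[OF T_comp_pullback, of "\<pi>0 \<cdot> \<zero> G" G2 "\<pi>1 \<cdot> V"] unfolding prolong_def by simp_all
  have "prolong V \<cdot> \<p> G2 = \<one> G2"
  proof (rule pullback_eqI[OF comp_pullback])
    show "(prolong V \<cdot> \<p> G2) \<cdot> \<pi>0 = \<one> G2 \<cdot> \<pi>0"
      using h Comp_extend[OF h(2), of "\<p> G"] by (simp add: proj_natural zero_proj)
    show "(prolong V \<cdot> \<p> G2) \<cdot> \<pi>1 = \<one> G2 \<cdot> \<pi>1"
      using h Comp_extend[OF h(3), of "\<p> G"] by (simp add: proj_natural)
  qed (use h in simp_all)
  then show "vector_field G2 (prolong V)" using h unfolding vector_field_def by simp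
  show "related \<pi>0 (prolong V) (\<zero> G)" "related \<pi>1 (prolong V) V"
    using h unfolding related_def by simp_all
qed

lemma prolong_unique:
  assumes "U \<in> hom X G2 (TO X G2)" "related \<pi>0 U (\<zero> G)" "related \<pi>1 U V"
  shows "U = prolong V"
  using pair_proj[OF T_comp_pullback, of U G2] assms unfolding related_def prolong_def by simp

text \<open>
  Each of the conditions is a relatedness condition, along \<open>s\<close>, \<open>\<pi>\<^sub>0\<close>, \<open>\<pi>\<^sub>1\<close> or \<open>\<mu>\<close>, and brackets
  inherit it. The bracket of the prolongations is recognised as a prolongation by its components.
\<close>

lemma left_invariant_lie_bracket:
  assumes V: "left_invariant V" and W: "left_invariant W"
  shows "left_invariant (lie_bracket X G V W)"
proof -
  let ?U = "lie_bracket X G2 (prolong V) (prolong W)"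
  note v = V[unfolded left_invariant_def] and w = W[unfolded left_invariant_def]
  note pv = prolong[of V] and pw = prolong[of W]
  have vf: "vector_field G (lie_bracket X G V W)" using lie_bracket(1) v w by blast
  have U: "vector_field G2 ?U" using lie_bracket(1) v w pv pw by blast
  have "related src (lie_bracket X G V W) (lie_bracket X M (\<zero> M) (\<zero> M))"
    by (rule lie_bracket_related) (use v w in \<open>simp_all add: vector_field_zero\<close>)
  then have src: "related src (lie_bracket X G V W) (\<zero> M)" by (simp add: lie_bracket_zero)
  have "related \<pi>0 ?U (lie_bracket X G (\<zero> G) (\<zero> G))"
    by (rule lie_bracket_related) (use v w pv pw in \<open>simp_all add: vector_field_zero\<close>)
  then have "related \<pi>0 ?U (\<zero> G)" by (simp add: lie_bracket_zero)
  moreover have "related \<pi>1 ?U (lie_bracket X G V W)"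
    by (rule lie_bracket_related) (use v w pv pw in simp_all)
  ultimately have "?U = prolong (lie_bracket X G V W)"
    using prolong_unique U unfolding vector_field_def by blast
  moreover have "related \<mu> ?U (lie_bracket X G V W)"
    by (rule lie_bracket_related) (use v w pv pw in simp_all)
  ultimately show ?thesis using vf src unfolding left_invariant_def by simp
qed

lemma mus_pairable:
  "act0 \<G> \<cdot> \<zero> G \<in> hom X (Dom X (act0 \<G>)) (TO X G)"
  "act1 \<G> \<cdot> \<iota> \<in> hom X (Dom X (act0 \<G>)) (TO X G)"
  "(act0 \<G> \<cdot> \<zero> G) \<cdot> \<T> tgt = (act1 \<G> \<cdot> \<iota>) \<cdot> \<T> src"
  using Comp_extend[OF act_square, of "\<zero> M"] by (simp_all add: zero_natural TsG_square)

text \<open>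
  The product of a zero vector with a vector tangent to a source fibre is again tangent to a source
  fibre because \<open>\<mu> s = \<pi>\<^sub>0 s\<close>; this is what makes the action \<open>\<mu>\<^sup>s\<close> exist.
\<close>

lemma mus:
  shows "mus X \<G> \<in> hom X (Dom X (act0 \<G>)) (Dom X \<iota>)"
    and "mus X \<G> \<cdot> \<iota> =
      pair X (\<T> \<pi>0) (\<T> \<pi>1) (act0 \<G> \<cdot> \<zero> G) (act1 \<G> \<cdot> \<iota>) \<cdot> \<T> \<mu>"
proof -
  let ?h = "pair X (\<T> \<pi>0) (\<T> \<pi>1) (act0 \<G> \<cdot> \<zero> G) (act1 \<G> \<cdot> \<iota>)"
  have h: "?h \<in> hom X (Dom X (act0 \<G>)) (TO X G2)" "?h \<cdot> \<T> \<pi>0 = act0 \<G> \<cdot> \<zero> G"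
    using pair[OF T_comp_pullback, of "act0 \<G> \<cdot> \<zero> G" "Dom X (act0 \<G>)" "act1 \<G> \<cdot> \<iota>"]
      mus_pairable by simp_all
  have "\<T> \<mu> \<cdot> \<T> src = \<T> \<pi>0 \<cdot> \<T> src"
    using arg_cong[OF mul_src, of \<T>] by simp
  then have "(?h \<cdot> \<T> \<mu>) \<cdot> \<T> src = (act0 \<G> \<cdot> src) \<cdot> \<zero> M"
    using h(1) Comp_extend[OF h(2), of "\<T> src"] by (simp add: zero_natural)
  then have "\<exists>!m. m \<in> hom X (Dom X (act0 \<G>)) (Dom X \<iota>) \<and> m \<cdot> \<iota> = ?h \<cdot> \<T> \<mu> \<and>
      m \<cdot> \<pi>\<^sub>s = act0 \<G> \<cdot> src"
    by (intro pair_unique[OF TsG_pullback]) (use h(1) in simp_all)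
  from theI'[OF this] show "mus X \<G> \<in> hom X (Dom X (act0 \<G>)) (Dom X \<iota>)"
    "mus X \<G> \<cdot> \<iota> = ?h \<cdot> \<T> \<mu>"
    unfolding mus_def TsG_def by blast+
qed

text \<open>
  A section of \<open>p\<^sup>s\<close> is the same as a vector field related to \<open>0\<close> along the source, and composing the
  equivariance equation with the monic \<open>\<iota>\<^sup>s\<close> turns it into relatedness along the multiplication.
\<close>

lemma LeftInv_iff:
  assumes Z: "Z \<in> hom X G (Dom X \<iota>)"
  shows "Z \<in> LeftInv X \<G> \<longleftrightarrow> left_invariant (Z \<cdot> \<iota>)"
proof (cases "(Z \<cdot> \<iota>) \<cdot> \<p> G = \<one> G")
  case False
  then show ?thesis
    using Z unfolding LeftInv_def ps_def TsG_def left_invariant_def vector_field_def by simp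
next
  case True
  note [simp] = Z[simplified]
  have vf: "vector_field G (Z \<cdot> \<iota>)" using True unfolding vector_field_def by simp
  have base: "Z \<cdot> \<pi>\<^sub>s = src"
    using TsG_base[OF Z] Comp_extend[OF True, of src] by simp
  then have src: "related src (Z \<cdot> \<iota>) (\<zero> M)"
    using Comp_extend[OF base, of "\<zero> M"] unfolding related_def by (simp add: TsG_square)
  let ?h = "pair X (act0 \<G>) (act1 \<G>) \<pi>0 (\<pi>1 \<cdot> Z)"
  have h: "?h \<in> hom X G2 (Dom X (act0 \<G>))" "?h \<cdot> act0 \<G> = \<pi>0" "?h \<cdot> act1 \<G> = \<pi>1 \<cdot> Z"
    using pair[OF act_pullback, of \<pi>0 G2 "\<pi>1 \<cdot> Z"] composable base by simp_all
  have "(?h \<cdot> mus X \<G>) \<cdot> \<iota> =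
      (?h \<cdot> pair X (\<T> \<pi>0) (\<T> \<pi>1) (act0 \<G> \<cdot> \<zero> G) (act1 \<G> \<cdot> \<iota>)) \<cdot> \<T> \<mu>"
    using h(1) mus pair(1)[OF T_comp_pullback, of "act0 \<G> \<cdot> \<zero> G" "Dom X (act0 \<G>)" "act1 \<G> \<cdot> \<iota>"]
      mus_pairable by simp
  also have "?h \<cdot> pair X (\<T> \<pi>0) (\<T> \<pi>1) (act0 \<G> \<cdot> \<zero> G) (act1 \<G> \<cdot> \<iota>) = prolong (Z \<cdot> \<iota>)"
    using Comp_pair[OF T_comp_pullback, of "act0 \<G> \<cdot> \<zero> G" "Dom X (act0 \<G>)" "act1 \<G> \<cdot> \<iota>" ?h G2]
      mus_pairable h(1) Comp_extend[OF h(2), of "\<zero> G"] Comp_extend[OF h(3), of \<iota>]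
    unfolding prolong_def by simp
  finally have eq: "(?h \<cdot> mus X \<G>) \<cdot> \<iota> = prolong (Z \<cdot> \<iota>) \<cdot> \<T> \<mu>" .
  have "?h \<cdot> mus X \<G> = \<mu> \<cdot> Z" if "(?h \<cdot> mus X \<G>) \<cdot> \<iota> = (\<mu> \<cdot> Z) \<cdot> \<iota>"
    by (rule TsG_monic[OF _ _ that]) (use h(1) mus(1) in simp_all)
  then have "?h \<cdot> mus X \<G> = \<mu> \<cdot> Z \<longleftrightarrow> (?h \<cdot> mus X \<G>) \<cdot> \<iota> = (\<mu> \<cdot> Z) \<cdot> \<iota>"
    by metis
  then have "?h \<cdot> mus X \<G> = \<mu> \<cdot> Z \<longleftrightarrow> related \<mu> (prolong (Z \<cdot> \<iota>)) (Z \<cdot> \<iota>)"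
    unfolding eq related_def by simp
  then show ?thesis
    using vf src Z unfolding LeftInv_def ps_def TsG_def left_invariant_def vector_field_def by simp
qed

text \<open>
  That the bracket is related to \<open>0\<close> along the source is the condition for it to factor through
  \<open>\<iota>\<^sup>s\<close>, so the description defining \<open>left_bracket\<close> denotes.
\<close>

lemma left_bracket:
  assumes "left_invariant (V \<cdot> \<iota>)" "left_invariant (W \<cdot> \<iota>)"
  shows "left_bracket X \<G> V W \<in> hom X G (Dom X \<iota>)"
    and "left_bracket X \<G> V W \<cdot> \<iota> = lie_bracket X G (V \<cdot> \<iota>) (W \<cdot> \<iota>)"
proof -
  let ?u = "lie_bracket X G (V \<cdot> \<iota>) (W \<cdot> \<iota>)"
  have u: "?u \<in> hom X G (TO X G)" "?u \<cdot> \<T> src = src \<cdot> \<zero> M"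
    using left_invariant_lie_bracket[OF assms]
    unfolding left_invariant_def vector_field_def related_def by simp_all
  have "pair X \<iota> \<pi>\<^sub>s ?u src \<in> hom X G (Dom X \<iota>)" "pair X \<iota> \<pi>\<^sub>s ?u src \<cdot> \<iota> = ?u"
    using pair[OF TsG_pullback, of ?u G src] u by simp_all
  then have "\<exists>!Z. Z \<in> hom X G (Dom X \<iota>) \<and> Z \<cdot> \<iota> = ?u" using TsG_monic by metis
  from theI'[OF this] show "left_bracket X \<G> V W \<in> hom X G (Dom X \<iota>)"
    "left_bracket X \<G> V W \<cdot> \<iota> = ?u"
    unfolding left_bracket_def TsG_def by blast+
qed

end

theorem lemma3p6:
  fixes \<X> :: "('o, 'a, 'm) tangent_neg_scheme"
    and \<G> :: "('o, 'a) groupoid"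
    and X Y :: 'a
  assumes "tangent_category_with_negatives \<X>"
    and "groupoid_in \<X> \<G>"
    and "X \<in> LeftInv \<X> \<G>"
    and "Y \<in> LeftInv \<X> \<G>"
  shows "left_bracket \<X> \<G> X Y \<in> LeftInv \<X> \<G>"
proof -
  interpret internal_groupoid \<X> \<G>
    using assms(1,2) by (simp add: internal_groupoid_def internal_groupoid_axioms_def)
  have "X \<in> hom \<X> G (Dom \<X> \<iota>)" "Y \<in> hom \<X> G (Dom \<X> \<iota>)"
    using assms(3,4) unfolding LeftInv_def TsG_def by auto
  then have XY: "left_invariant (Comp \<X> X \<iota>)" "left_invariant (Comp \<X> Y \<iota>)"
    using assms(3,4) LeftInv_iff by blast+
  show ?thesis
    using LeftInv_iff[OF left_bracket(1)[OF XY]] left_bracket(2)[OF XY]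
      left_invariant_lie_bracket[OF XY] by simp
qed

end
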